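(* Let $\mathbf r(t)$ be a non-planar rational parametric space curve defined on an interval $I$ and let $t_0\in I$ be a parameter that is not the right endpoint of $I$. Then there exists $t_1>t_0$, $t_1\in I$, such that the segment $\mathbf r(t)$, $t\in[t_0,t_1]$, is a quasi-cubic Bézier segment.
   Context: Setting: $\mathbf r(t)=(x(t),y(t),z(t))$ with $x,y,z$ rational functions with real coefficients whose denominators do not vanish on the parameter interval, properly parametrized, and not contained in a plane (curvature $\kappa$ and torsion $\tau$ not identically zero). Here $\kappa=\|\mathbf r'\times\mathbf r''\|/\|\mathbf r'\|^3$ and $\tau$ vanishes exactly where $\det(\mathbf r',\mathbf r'',\mathbf r''')=0$. Unit tangent $\boldsymbol\alpha=\mathbf r'/\|\mathbf r'\|$, unit binormal $\boldsymbol\gamma=\mathbf r'\times\mathbf r''/\|\mathbf r'\times\mathbf r''\|$; at any parameter $s$ one uses the one-sided limits $\boldsymbol\alpha^{\pm}(s)=\lim_{t\to s^\pm}\boldsymbol\alpha(t)$, $\boldsymbol\gamma^{\pm}(s)=\lim_{t\to s^\pm}\boldsymbol\gamma(t)$ (which exist for rational curves); tangent lines $T^{\pm}(s)=\{\mathbf r(s)+\lambda\boldsymbol\alpha^{\pm}(s)\}$, osculating planes $O^{\pm}(s)=\{X:(X-\mathbf r(s))\cdot\boldsymbol\gamma^{\pm}(s)=0\}$ (at ordinary points the $\pm$ versions coincide and are written $O(s)$, $T(s)$). A point is singular if it corresponds to more than one parameter counted with multiplicity. Associated tetrahedron of the segment $[t_0,t_1]$: $\mathbf r_0=\mathbf r(t_0)$,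 $\mathbf r_3=\mathbf r(t_1)$, $L=O^+(t_0)\cap O^-(t_1)$, $\mathbf r_1=T^+(t_0)\cap L$, $\mathbf r_2=T^-(t_1)\cap L$; the tetrahedron $\mathbf r_0\mathbf r_1\mathbf r_2\mathbf r_3$ (requires these intersections to exist and $\mathbf r_1\neq\mathbf r_2$). For $t_0\le a<b\le t_1$ the associated tetrahedron of $[a,b]$ is defined the same way. Parallel point: for a segment lying on one side of a plane $Q$ with both endpoints on $Q$, a point $\mathbf r(t)$, $t$ interior, with $\mathbf r'(t)$ parallel to $Q$. Quasi-cubic Bézier segment: a segment $\mathbf r(t)$, $t\in[t_0,t_1]$, whose associated tetrahedron $\mathbf r_0\mathbf r_1\mathbf r_2\mathbf r_3$ is non-degenerate and which has the following eight properties: (Q1) the one-sided tangent directions at $t_0$ and $t_1$ are parallel to $\mathbf r_0\mathbf r_1$ and $\mathbf r_2\mathbf r_3$; (Q2) the planes $\mathbf r_0\mathbf r_1\mathbf r_2$ and $\mathbf r_1\mathbf r_2\mathbf r_3$ are $O^+(t_0)$ and $O^-(t_1)$; (Q3) $\mathbf r([t_0,t_1])$ lies in the tetrahedron; (Q4) the segment has no singular points and $\kappa(t)\ne0$, $\tau(t)\ne0$ for $t\in(t_0,t_1)$; (Q5) for all $t_0\le a<b\le t_1$ the associated tetrahedron of $[a,b]$ lies in $\mathbf r_0\mathbf r_1\mathbf r_2\mathbf r_3$; (Q6) for $t^\star\in(t_0,t_1)$, $O(t^\star)$ meets the lines $\mathbf r_0\mathbf r_1,\mathbf r_1\mathbf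 r_2,\mathbf r_2\mathbf r_3$ at points $\mathbf r_{01},\mathbf r_{12},\mathbf r_{23}$ and $\|\mathbf r_0\mathbf r_{01}\|,\|\mathbf r_1\mathbf r_{12}\|,\|\mathbf r_2\mathbf r_{23}\|$ are strictly monotone in $t^\star$; (Q7) with $\mathbf r_{03}$ the intersection of the plane $\mathbf r_1\mathbf r_2\mathbf r(t^\star)$ with line $\mathbf r_0\mathbf r_3$ and $\mathbf r_{12}'$ the intersection of the plane $\mathbf r_0\mathbf r_3\mathbf r(t^\star)$ with line $\mathbf r_1\mathbf r_2$, $\|\mathbf r_0\mathbf r_{03}\|$ and $\|\mathbf r_1\mathbf r_{12}'\|$ are strictly monotone in $t^\star\in(t_0,t_1)$; (Q8) there is exactly one parallel point associated to the plane $\mathbf r_0\mathbf r_2\mathbf r_3$ and exactly one associated to the plane $\mathbf r_0\mathbf r_1\mathbf r_3$, and they are the points of the segment at maximal distance from these planes. *)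

theory Defs
  imports "HOL-Analysis.Analysis" "HOL-Computational_Algebra.Polynomial"
begin

definition rat_curve :: "real poly ^ 3 \<Rightarrow> real poly ^ 3 \<Rightarrow> real \<Rightarrow> real ^ 3" where
  "rat_curve p q t = (\<chi> i. poly (p $ i) t / poly (q $ i) t)"

definition rat_curve_c :: "real poly ^ 3 \<Rightarrow> real poly ^ 3 \<Rightarrow> complex \<Rightarrow> 3 \<Rightarrow> complex" where
  "rat_curve_c p q z i = poly (map_poly complex_of_real (p $ i)) z / poly (map_poly complex_of_real (q $ i)) z"

definition defined_at_c :: "real poly ^ 3 \<Rightarrow> complex \<Rightarrow> bool" where
  "defined_at_c q z \<longleftrightarrow> (\<forall>i. poly (map_poly complex_of_real (q $ i)) z \<noteq> 0)"

definition proper_param :: "real poly ^ 3 \<Rightarrow> real poly ^ 3 \<Rightarrow> bool" where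
  "proper_param p q \<longleftrightarrow>
     finite {z. defined_at_c q z \<and>
                (\<exists>w. w \<noteq> z \<and> defined_at_c q w \<and> rat_curve_c p q w = rat_curve_c p q z)}"

definition non_planar :: "(real \<Rightarrow> real ^ 3) \<Rightarrow> real set \<Rightarrow> bool" where
  "non_planar r I \<longleftrightarrow> \<not> (\<exists>n c. n \<noteq> 0 \<and> (\<forall>t\<in>I. n \<bullet> r t = c))"

definition d1 :: "(real \<Rightarrow> real ^ 3) \<Rightarrow> real \<Rightarrow> real ^ 3" where
  "d1 r t = vector_derivative r (at t)"

definition d2 :: "(real \<Rightarrow> real ^ 3) \<Rightarrow> real \<Rightarrow> real ^ 3" where
  "d2 r t = vector_derivative (d1 r) (at t)"

definition d3 :: "(real \<Rightarrow> real ^ 3) \<Rightarrow> real \<Rightarrow> real ^ 3" where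
  "d3 r t = vector_derivative (d2 r) (at t)"

definition curvature :: "(real \<Rightarrow> real ^ 3) \<Rightarrow> real \<Rightarrow> real" where
  "curvature r t = norm (cross3 (d1 r t) (d2 r t)) / norm (d1 r t) ^ 3"

definition torsion :: "(real \<Rightarrow> real ^ 3) \<Rightarrow> real \<Rightarrow> real" where
  "torsion r t = (cross3 (d1 r t) (d2 r t) \<bullet> d3 r t) / norm (cross3 (d1 r t) (d2 r t)) ^ 2"

definition unit_tangent :: "(real \<Rightarrow> real ^ 3) \<Rightarrow> real \<Rightarrow> real ^ 3" where
  "unit_tangent r t = (1 / norm (d1 r t)) *\<^sub>R d1 r t"

definition unit_binormal :: "(real \<Rightarrow> real ^ 3) \<Rightarrow> real \<Rightarrow> real ^ 3" where
  "unit_binormal r t = (1 / norm (cross3 (d1 r t) (d2 r t))) *\<^sub>R cross3 (d1 r t) (d2 r t)"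

definition tangent_plus :: "(real \<Rightarrow> real ^ 3) \<Rightarrow> real \<Rightarrow> real ^ 3" where
  "tangent_plus r s = Lim (at_right s) (unit_tangent r)"

definition tangent_minus :: "(real \<Rightarrow> real ^ 3) \<Rightarrow> real \<Rightarrow> real ^ 3" where
  "tangent_minus r s = Lim (at_left s) (unit_tangent r)"

definition binormal_plus :: "(real \<Rightarrow> real ^ 3) \<Rightarrow> real \<Rightarrow> real ^ 3" where
  "binormal_plus r s = Lim (at_right s) (unit_binormal r)"

definition binormal_minus :: "(real \<Rightarrow> real ^ 3) \<Rightarrow> real \<Rightarrow> real ^ 3" where
  "binormal_minus r s = Lim (at_left s) (unit_binormal r)"

definition tline_plus :: "(real \<Rightarrow> real ^ 3) \<Rightarrow> real \<Rightarrow> (real ^ 3) set" where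
  "tline_plus r s = {r s + c *\<^sub>R tangent_plus r s | c. True}"

definition tline_minus :: "(real \<Rightarrow> real ^ 3) \<Rightarrow> real \<Rightarrow> (real ^ 3) set" where
  "tline_minus r s = {r s + c *\<^sub>R tangent_minus r s | c. True}"

definition osc_plus :: "(real \<Rightarrow> real ^ 3) \<Rightarrow> real \<Rightarrow> (real ^ 3) set" where
  "osc_plus r s = {X. (X - r s) \<bullet> binormal_plus r s = 0}"

definition osc_minus :: "(real \<Rightarrow> real ^ 3) \<Rightarrow> real \<Rightarrow> (real ^ 3) set" where
  "osc_minus r s = {X. (X - r s) \<bullet> binormal_minus r s = 0}"

definition osc :: "(real \<Rightarrow> real ^ 3) \<Rightarrow> real \<Rightarrow> (real ^ 3) set" where
  "osc r s = {X. (X - r s) \<bullet> unit_binormal r s = 0}"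

text \<open>Singular point: r(t) corresponds to more than one parameter of I counted with
 multiplicity (another parameter, or t itself with multiplicity > 1, i.e. r'(t) = 0).\<close>
definition singular_param :: "(real \<Rightarrow> real ^ 3) \<Rightarrow> real set \<Rightarrow> real \<Rightarrow> bool" where
  "singular_param r I t \<longleftrightarrow> (\<exists>s\<in>I. s \<noteq> t \<and> r s = r t) \<or> d1 r t = 0"

definition assoc_tet :: "(real \<Rightarrow> real ^ 3) \<Rightarrow> real \<Rightarrow> real \<Rightarrow>
    real ^ 3 \<Rightarrow> real ^ 3 \<Rightarrow> real ^ 3 \<Rightarrow> real ^ 3 \<Rightarrow> bool" where
  "assoc_tet r a b r0 r1 r2 r3 \<longleftrightarrow>
     r0 = r a \<and> r3 = r b \<and>
     tline_plus r a \<inter> (osc_plus r a \<inter> osc_minus r b) = {r1} \<and>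
     tline_minus r b \<inter> (osc_plus r a \<inter> osc_minus r b) = {r2} \<and>
     r1 \<noteq> r2"

definition parallel_vec :: "real ^ 3 \<Rightarrow> real ^ 3 \<Rightarrow> bool" where
  "parallel_vec u v \<longleftrightarrow> u \<noteq> 0 \<and> v \<noteq> 0 \<and> cross3 u v = 0"

definition strictly_monotone_on :: "real set \<Rightarrow> (real \<Rightarrow> real) \<Rightarrow> bool" where
  "strictly_monotone_on S f \<longleftrightarrow>
     (\<forall>x\<in>S. \<forall>y\<in>S. x < y \<longrightarrow> f x < f y) \<or> (\<forall>x\<in>S. \<forall>y\<in>S. x < y \<longrightarrow> f x > f y)"

definition parallel_to_plane :: "real ^ 3 \<Rightarrow> (real ^ 3) set \<Rightarrow> bool" where
  "parallel_to_plane v Q \<longleftrightarrow> (\<exists>a\<in>Q. a + v \<in> Q)"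

text \<open>Parallel points of the segment [t0,t1] w.r.t. a plane Q (the segment being on
 one side of Q with both endpoints on Q).\<close>
definition parallel_points :: "(real \<Rightarrow> real ^ 3) \<Rightarrow> real \<Rightarrow> real \<Rightarrow> (real ^ 3) set \<Rightarrow> (real ^ 3) set" where
  "parallel_points r t0 t1 Q = {r t | t. t0 < t \<and> t < t1 \<and> parallel_to_plane (d1 r t) Q}"

definition farthest_points :: "(real \<Rightarrow> real ^ 3) \<Rightarrow> real \<Rightarrow> real \<Rightarrow> (real ^ 3) set \<Rightarrow> (real ^ 3) set" where
  "farthest_points r t0 t1 Q =
     {x \<in> r ` {t0..t1}. \<forall>y \<in> r ` {t0..t1}. infdist y Q \<le> infdist x Q}"

definition quasi_cubic :: "(real \<Rightarrow> real ^ 3) \<Rightarrow> real set \<Rightarrow> real \<Rightarrow> real \<Rightarrow> bool" where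
  "quasi_cubic r I t0 t1 \<longleftrightarrow> t0 < t1 \<and>
   (\<exists>r0 r1 r2 r3. assoc_tet r t0 t1 r0 r1 r2 r3 \<and> \<not> coplanar {r0, r1, r2, r3} \<and>
     \<comment> \<open>Q1\<close>
     parallel_vec (tangent_plus r t0) (r1 - r0) \<and> parallel_vec (tangent_minus r t1) (r3 - r2) \<and>
     \<comment> \<open>Q2\<close>
     affine hull {r0, r1, r2} = osc_plus r t0 \<and> affine hull {r1, r2, r3} = osc_minus r t1 \<and>
     \<comment> \<open>Q3\<close>
     r ` {t0..t1} \<subseteq> convex hull {r0, r1, r2, r3} \<and>
     \<comment> \<open>Q4\<close>
     (\<forall>t. t0 < t \<and> t < t1 \<longrightarrow>
        \<not> singular_param r I t \<and> curvature r t \<noteq> 0 \<and> torsion r t \<noteq> 0) \<and>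
     \<comment> \<open>Q5\<close>
     (\<forall>a b. t0 \<le> a \<and> a < b \<and> b \<le> t1 \<longrightarrow>
        (\<exists>s0 s1 s2 s3. assoc_tet r a b s0 s1 s2 s3 \<and>
           convex hull {s0, s1, s2, s3} \<subseteq> convex hull {r0, r1, r2, r3})) \<and>
     \<comment> \<open>Q6\<close>
     (\<exists>p01 p12 p23.
        (\<forall>t. t0 < t \<and> t < t1 \<longrightarrow>
           osc r t \<inter> affine hull {r0, r1} = {p01 t} \<and>
           osc r t \<inter> affine hull {r1, r2} = {p12 t} \<and>
           osc r t \<inter> affine hull {r2, r3} = {p23 t}) \<and>
        strictly_monotone_on {t0<..<t1} (\<lambda>t. dist r0 (p01 t)) \<and>
        strictly_monotone_on {t0<..<t1} (\<lambda>t. dist r1 (p12 t)) \<and>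
        strictly_monotone_on {t0<..<t1} (\<lambda>t. dist r2 (p23 t))) \<and>
     \<comment> \<open>Q7\<close>
     (\<exists>p03 q12.
        (\<forall>t. t0 < t \<and> t < t1 \<longrightarrow>
           \<not> collinear {r1, r2, r t} \<and> \<not> collinear {r0, r3, r t} \<and>
           affine hull {r1, r2, r t} \<inter> affine hull {r0, r3} = {p03 t} \<and>
           affine hull {r0, r3, r t} \<inter> affine hull {r1, r2} = {q12 t}) \<and>
        strictly_monotone_on {t0<..<t1} (\<lambda>t. dist r0 (p03 t)) \<and>
        strictly_monotone_on {t0<..<t1} (\<lambda>t. dist r1 (q12 t))) \<and>
     \<comment> \<open>Q8\<close>
     (\<exists>p. parallel_points r t0 t1 (affine hull {r0, r2, r3}) = {p} \<and>
          farthest_points r t0 t1 (affine hull {r0, r2, r3}) = {p}) \<and>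
     (\<exists>p. parallel_points r t0 t1 (affine hull {r0, r1, r3}) = {p} \<and>
          farthest_points r t0 t1 (affine hull {r0, r1, r3}) = {p}))"

end

theory Submission
  imports Defs
begin

text \<open>
  At \<open>t0\<close> a non-planar rational curve has a flag \<open>e1, e2, e3\<close> in which its coordinates \<open>x, f, g\<close> vanish
  to strictly increasing orders. Hence \<open>x\<close>, \<open>y = f'/x'\<close>, \<open>p = g'/x'\<close> and \<open>w = p'/y'\<close> extend continuously
  by \<open>0\<close>, and \<open>x', y', w'\<close> are positive on some \<open>(t0, t1]\<close>. This positivity persists if the
  curve is rewritten in the flag of any later point and if it is reversed. Every inequality behind the
  eight properties is a positive polynomial identity in these data, or follows by integrating
  one: for instance the osculating plane at \<open>t\<close> cuts the first edge at \<open>D/A\<close>, whose derivative is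
  \<open>w' P / A^2\<close> with \<open>A, P > 0\<close>. A tetrahedron of a subsegment is compared with the full one by moving one
  endpoint at a time. Properness only excludes double points.\<close>

text \<open>The obstacle is the endpoint \<open>t0\<close>: r' may vanish there, so neither a Taylor
  expansion with orders 1, 2, 3 nor the Frenet frame is available. The frame e1 + y e2 + p e3, e2 +
  w e3, e3 replaces both. Being triangular over a fixed flag it never degenerates, and the speeds
  x', y', w', which may vanish at the endpoints, stay outside it. No asymptotic estimate as t1 tends
  to t0 occurs: smallness of the segment is spent only on obtaining the signs of the speeds and on
  avoiding the finitely many parameters of double points. The positivity argument therefore holds at
  once for all subsegments, as Q5 demands.\<close>

section \<open>Monotonicity from signs of derivatives\<close>

text \<open>Derivatives are used only inside the interval, because a chain may be singular at either
  end; the conclusion still reaches \<open>b\<close>, where many quantities get evaluated.\<close>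

lemma pos_of_deriv_pos:
  fixes h h' :: "real \<Rightarrow> real"
  assumes "continuous_on {a..b} h" "h a \<ge> 0"
    and "\<And>t. a < t \<Longrightarrow> t < b \<Longrightarrow> (h has_real_derivative h' t) (at t)"
    and "\<And>t. a < t \<Longrightarrow> t < b \<Longrightarrow> h' t > 0"
    and "a < t" "t \<le> b"
  shows "h t > 0"
proof -
  have "h a < h t"
  proof (rule DERIV_pos_imp_increasing_open[OF \<open>a < t\<close>])
    show "\<exists>y. (h has_real_derivative y) (at z) \<and> 0 < y" if "a < z" "z < t" for z
      using assms(3,4)[of z] assms(6) that by auto
  qed (use assms in \<open>auto intro: continuous_on_subset\<close>)
  with assms(2) show ?thesis by simp
qed

text \<open>\<open>W\<close> is the numerator in the quotient rule: monotonicity of a ratio reduces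
  to the sign of one polynomial expression.\<close>

lemma ratio_less_of_deriv:
  fixes u v u' v' :: "real \<Rightarrow> real"
  assumes "s < t" "continuous_on {s..t} u" "continuous_on {s..t} v"
    and v: "\<And>z. s \<le> z \<Longrightarrow> z \<le> t \<Longrightarrow> v z > 0"
    and u': "\<And>z. s < z \<Longrightarrow> z < t \<Longrightarrow> (u has_real_derivative u' z) (at z)"
    and v': "\<And>z. s < z \<Longrightarrow> z < t \<Longrightarrow> (v has_real_derivative v' z) (at z)"
    and W: "\<And>z. s < z \<Longrightarrow> z < t \<Longrightarrow> u' z * v z - u z * v' z > 0"
  shows "u s / v s < u t / v t"
proof (rule DERIV_pos_imp_increasing_open[OF \<open>s < t\<close>, where f = "\<lambda>z. u z / v z"])
  fix z assume z: "s < z" "z < t"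
  have "((\<lambda>z. u z / v z) has_real_derivative (u' z * v z - u z * v' z) / (v z * v z)) (at z)"
    using DERIV_divide[OF u'[OF z] v'[OF z]] v[of z] z by simp
  moreover have "(u' z * v z - u z * v' z) / (v z * v z) > 0"
    using W[OF z] v[of z] z by simp
  ultimately show "\<exists>y. ((\<lambda>z. u z / v z) has_real_derivative y) (at z) \<and> 0 < y" by blast
next
  have "v z \<noteq> 0" if "z \<in> {s..t}" for z using v[of z] that by auto
  then show "continuous_on {s..t} (\<lambda>z. u z / v z)"
    using assms(2,3) by (intro continuous_on_divide) auto
qed

section \<open>Coordinate chains\<close>

text \<open>The coordinates of a curve \<open>r = r a + x e1 + f e2 + g e3\<close> in a flag \<open>e1, e2, e3\<close> at \<open>a\<close>.
  With \<open>T = e1 + y e2 + p e3\<close> and \<open>N = e2 + w e3\<close> the conditions say \<open>r' = x' T\<close>, \<open>T' = y' N\<close>,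
  \<open>N' = w' e3\<close>. The derivatives may vanish at the endpoints, where the curve may be singular.\<close>

locale chain =
  fixes a b :: real and x y w f p g x' y' w' :: "real \<Rightarrow> real"
  assumes ab: "a < b"
    and cont: "continuous_on {a..b} x" "continuous_on {a..b} y" "continuous_on {a..b} w"
      "continuous_on {a..b} f" "continuous_on {a..b} p" "continuous_on {a..b} g"
    and zero: "x a = 0" "y a = 0" "w a = 0" "f a = 0" "p a = 0" "g a = 0"
    and der: "\<And>t. a < t \<Longrightarrow> t < b \<Longrightarrow> (x has_real_derivative x' t) (at t)"
      "\<And>t. a < t \<Longrightarrow> t < b \<Longrightarrow> (y has_real_derivative y' t) (at t)"
      "\<And>t. a < t \<Longrightarrow> t < b \<Longrightarrow> (w has_real_derivative w' t) (at t)"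
      "\<And>t. a < t \<Longrightarrow> t < b \<Longrightarrow> (f has_real_derivative y t * x' t) (at t)"
      "\<And>t. a < t \<Longrightarrow> t < b \<Longrightarrow> (p has_real_derivative w t * y' t) (at t)"
      "\<And>t. a < t \<Longrightarrow> t < b \<Longrightarrow> (g has_real_derivative p t * x' t) (at t)"
    and pos: "\<And>t. a < t \<Longrightarrow> t < b \<Longrightarrow> x' t > 0"
      "\<And>t. a < t \<Longrightarrow> t < b \<Longrightarrow> y' t > 0"
      "\<And>t. a < t \<Longrightarrow> t < b \<Longrightarrow> w' t > 0"
begin

text \<open>In these coordinates the osculating plane at \<open>t\<close> is \<open>A t X - w t Y + Z = D t\<close>, and
  \<open>- P t, Q t, - R t\<close> are the components of the cross product of \<open>T t\<close> and \<open>r t - r a\<close>.\<close>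
definition "A t = y t * w t - p t"
definition "R t = x t * y t - f t"
definition "Q t = x t * p t - g t"
definition "P t = f t * p t - y t * g t"
definition "D t = x t * A t - f t * w t + g t"

text \<open>The cancellations are the point: each derivative becomes a single product of factors
  whose signs can be settled beforehand, so positivity propagates from the base point by
  integration.\<close>

lemma der_A: "a < t \<Longrightarrow> t < b \<Longrightarrow> (A has_real_derivative y t * w' t) (at t)"
  unfolding A_def[abs_def] by (auto intro!: derivative_eq_intros der simp: algebra_simps)

lemma der_R: "a < t \<Longrightarrow> t < b \<Longrightarrow> (R has_real_derivative x t * y' t) (at t)"
  unfolding R_def[abs_def] by (auto intro!: derivative_eq_intros der simp: algebra_simps)

lemma der_Q: "a < t \<Longrightarrow> t < b \<Longrightarrow> (Q has_real_derivative x t * w t * y' t) (at t)"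
  unfolding Q_def[abs_def] by (auto intro!: derivative_eq_intros der simp: algebra_simps)

lemma der_P: "a < t \<Longrightarrow> t < b \<Longrightarrow> (P has_real_derivative (f t * w t - g t) * y' t) (at t)"
  unfolding P_def[abs_def] by (auto intro!: derivative_eq_intros der simp: algebra_simps)

lemma der_D: "a < t \<Longrightarrow> t < b \<Longrightarrow> (D has_real_derivative R t * w' t) (at t)"
  unfolding D_def[abs_def] R_def
  by (auto intro!: derivative_eq_intros der der_A simp: algebra_simps A_def)

lemma cont_inv: "continuous_on {a..b} A" "continuous_on {a..b} R" "continuous_on {a..b} Q"
  "continuous_on {a..b} P" "continuous_on {a..b} D"
  unfolding A_def[abs_def] R_def[abs_def] Q_def[abs_def] P_def[abs_def] D_def[abs_def]
  by (intro continuous_intros cont)+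

lemma zero_inv: "A a = 0" "R a = 0" "Q a = 0" "P a = 0" "D a = 0"
  by (simp_all add: A_def R_def Q_def P_def D_def zero)

lemma pos_coord:
  assumes t: "a < t" "t \<le> b"
  shows "x t > 0" "y t > 0" "w t > 0"
  using pos_of_deriv_pos[OF cont(1) _ der(1) pos(1) t] pos_of_deriv_pos[OF cont(2) _ der(2) pos(2) t]
    pos_of_deriv_pos[OF cont(3) _ der(3) pos(3) t] zero by auto

lemma pos_f: "a < t \<Longrightarrow> t \<le> b \<Longrightarrow> f t > 0"
  using pos_of_deriv_pos[OF cont(4) _ der(4)] zero pos(1) pos_coord(2) by simp

lemma pos_p: "a < t \<Longrightarrow> t \<le> b \<Longrightarrow> p t > 0"
  using pos_of_deriv_pos[OF cont(5) _ der(5)] zero pos(2) pos_coord(3) by simp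

lemma pos_g: "a < t \<Longrightarrow> t \<le> b \<Longrightarrow> g t > 0"
  using pos_of_deriv_pos[OF cont(6) _ der(6)] zero pos(1) pos_p by simp

lemma pos_A: "a < t \<Longrightarrow> t \<le> b \<Longrightarrow> A t > 0"
  using pos_of_deriv_pos[OF cont_inv(1) _ der_A] zero_inv pos(3) pos_coord(2) by simp

lemma pos_R: "a < t \<Longrightarrow> t \<le> b \<Longrightarrow> R t > 0"
  using pos_of_deriv_pos[OF cont_inv(2) _ der_R] zero_inv pos(2) pos_coord(1) by simp

lemma pos_Q: "a < t \<Longrightarrow> t \<le> b \<Longrightarrow> Q t > 0"
  using pos_of_deriv_pos[OF cont_inv(3) _ der_Q] zero_inv pos(2) pos_coord by simp

lemma pos_D: "a < t \<Longrightarrow> t \<le> b \<Longrightarrow> D t > 0"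
  using pos_of_deriv_pos[OF cont_inv(5) _ der_D] zero_inv pos(3) pos_R by simp

text \<open>This is the factor in \<open>der_P\<close>; its own derivative splits into two positive
  terms.\<close>

lemma pos_fw_g: "a < t \<Longrightarrow> t \<le> b \<Longrightarrow> f t * w t - g t > 0"
proof -
  have "((\<lambda>t. f t * w t - g t) has_real_derivative f t * w' t + x' t * A t) (at t)"
    if "a < t" "t < b" for t using that
    by (auto intro!: derivative_eq_intros der simp: algebra_simps A_def)
  moreover have "f t * w' t + x' t * A t > 0" if "a < t" "t < b" for t
    using that pos[of t] pos_f[of t] pos_A[of t] by (simp add: add_pos_pos)
  ultimately show "a < t \<Longrightarrow> t \<le> b \<Longrightarrow> f t * w t - g t > 0"
    by (rule pos_of_deriv_pos[rotated 2]) (auto intro!: continuous_intros cont simp: zero)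
qed

lemma pos_P: "a < t \<Longrightarrow> t \<le> b \<Longrightarrow> P t > 0"
  using pos_of_deriv_pos[OF cont_inv(4) _ der_P] zero_inv pos(2) pos_fw_g by simp

lemmas pos_all = pos_coord pos_f pos_p pos_g pos_A pos_R pos_Q pos_D pos_P

lemma DA_less:
  assumes "a < s" "s < t" "t \<le> b"
  shows "D s / A s < D t / A t"
proof (rule ratio_less_of_deriv[OF assms(2)])
  fix z assume "s < z" "z < t"
  with assms have z: "a < z" "z < b" by auto
  have "R z * w' z * A z - D z * (y z * w' z) = w' z * P z"
    by (simp add: R_def D_def A_def P_def algebra_simps)
  then show "R z * w' z * A z - D z * (y z * w' z) > 0" using z pos pos_P by simp
qed (use assms in \<open>auto intro: der_D der_A continuous_on_subset[OF cont_inv(1)]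
     continuous_on_subset[OF cont_inv(5)] pos_A\<close>)

text \<open>The inner vertex \<open>vert2\<close> of [a, t] will have coordinates (Q/p, P/p, 0), so
  \<open>P/Q\<close> is the slope of the line from \<open>r a\<close> to it. Its growth keeps the
  vertices of shorter segments on the right side of the face r0 r2 r3.\<close>

lemma PQ_less:
  assumes "a < s" "s < t" "t \<le> b"
  shows "P s / Q s < P t / Q t"
proof (rule ratio_less_of_deriv[OF assms(2)])
  fix z assume "s < z" "z < t"
  with assms have z: "a < z" "z < b" by auto
  have "(f z * w z - g z) * y' z * Q z - P z * (x z * w z * y' z) = y' z * g z * D z"
    by (simp add: R_def D_def A_def P_def Q_def algebra_simps)
  then show "(f z * w z - g z) * y' z * Q z - P z * (x z * w z * y' z) > 0"
    using z pos pos_g pos_D by simp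
qed (use assms in \<open>auto intro: der_P der_Q continuous_on_subset[OF cont_inv(3)]
     continuous_on_subset[OF cont_inv(4)] pos_Q\<close>)

text \<open>\<open>p/y\<close> is the slope of the tangent after projection along \<open>e1\<close>;
  it drives \<open>S_unimodal\<close>.\<close>

lemma py_less:
  assumes "a < s" "s < t" "t \<le> b"
  shows "p s / y s < p t / y t"
proof (rule ratio_less_of_deriv[OF assms(2)])
  fix z assume "s < z" "z < t"
  with assms have z: "a < z" "z < b" by auto
  have "w z * y' z * y z - p z * y' z = y' z * A z"
    by (simp add: A_def algebra_simps)
  then show "w z * y' z * y z - p z * y' z > 0"
    using z pos pos_A by simp
qed (use assms in \<open>auto intro: der continuous_on_subset[OF cont(2)]
     continuous_on_subset[OF cont(5)] pos_coord\<close>)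

section \<open>Change of flag: later base points and reversal\<close>

text \<open>The coordinates in the flag at \<open>s\<close>.\<close>
definition "fh s t = f t - f s - y s * (x t - x s)"
definition "ph s t = p t - p s - w s * (y t - y s)"
definition "gh s t = g t - g s - p s * (x t - x s) - w s * fh s t"

text \<open>The flag at \<open>s\<close> will be \<open>T s\<close>, \<open>N s\<close>,
  \<open>e3\<close>. The three speeds are the same functions in every such flag, so their positivity
  is inherited.\<close>

lemma shift:
  assumes "a \<le> s" "s < c" "c \<le> b"
  shows "chain s c (\<lambda>t. x t - x s) (\<lambda>t. y t - y s) (\<lambda>t. w t - w s) (fh s) (ph s) (gh s) x' y' w'"
proof unfold_locales
  have *: "{s..c} \<subseteq> {a..b}" using assms by auto
  note c = cont[THEN continuous_on_subset, OF *]
  show "continuous_on {s..c} (\<lambda>t. x t - x s)" "continuous_on {s..c} (\<lambda>t. y t - y s)"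
    "continuous_on {s..c} (\<lambda>t. w t - w s)" "continuous_on {s..c} (fh s)" "continuous_on {s..c} (ph s)"
    "continuous_on {s..c} (gh s)" unfolding fh_def[abs_def] ph_def[abs_def] gh_def[abs_def]
    by (intro continuous_intros c)+
  fix t assume "s < t" "t < c"
  then have t: "a < t" "t < b" using assms by auto
  show "0 < x' t" "0 < y' t" "0 < w' t" using pos t by auto
  show "((\<lambda>t. x t - x s) has_real_derivative x' t) (at t)"
    "((\<lambda>t. y t - y s) has_real_derivative y' t) (at t)"
    "((\<lambda>t. w t - w s) has_real_derivative w' t) (at t)"
    "(fh s has_real_derivative (y t - y s) * x' t) (at t)"
    "(ph s has_real_derivative (w t - w s) * y' t) (at t)"
    "(gh s has_real_derivative ph s t * x' t) (at t)"
    unfolding fh_def[abs_def] ph_def[abs_def] gh_def[abs_def]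
    by (auto intro!: derivative_eq_intros der t simp: algebra_simps)
qed (use assms in \<open>auto simp: fh_def ph_def gh_def\<close>)

lemma hat_pos:
  assumes "a \<le> s" "s < t" "t \<le> b"
  shows "x s < x t" "y s < y t" "w s < w t" "fh s t > 0" "ph s t > 0" "gh s t > 0"
    "fh s t * ph s t - (y t - y s) * gh s t > 0"
proof -
  interpret S: chain s t "\<lambda>t. x t - x s" "\<lambda>t. y t - y s" "\<lambda>t. w t - w s" "fh s" "ph s" "gh s" x' y' w'
    by (rule shift[OF assms])
  show "x s < x t" "y s < y t" "w s < w t" "fh s t > 0" "ph s t > 0" "gh s t > 0"
    using S.pos_all[of t] assms by auto
  show "fh s t * ph s t - (y t - y s) * gh s t > 0" using S.pos_P[of t] assms by (simp add: S.P_def)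
qed

text \<open>The coordinates \<open>p\<close> and \<open>g\<close> of the reversed curve in the flag at \<open>b\<close>.\<close>
definition "Hb t = A b - w b * y t + p t"
definition "Gb t = D b - A b * x t + w b * f t - g t"

text \<open>\<open>Hb t\<close> and \<open>Gb t\<close> are the quantities \<open>A\<close> and
  \<open>D\<close> of the chain restarted at \<open>t\<close>, evaluated at \<open>b\<close>: end
  point and base point exchange their roles.\<close>

lemma Hb_Gb_pos:
  assumes "a \<le> t" "t < b"
  shows "Hb t > 0" "Gb t > 0"
proof -
  interpret S: chain t b "\<lambda>s. x s - x t" "\<lambda>s. y s - y t" "\<lambda>s. w s - w t" "fh t" "ph t" "gh t" x' y' w'
    by (rule shift) (use assms in auto)
  show "Hb t > 0" using S.pos_A[of b] assms
    by (simp add: Hb_def A_def S.A_def ph_def algebra_simps)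
  show "Gb t > 0" using S.pos_D[of b] assms
    by (simp add: Gb_def A_def D_def S.A_def S.D_def fh_def gh_def ph_def algebra_simps)
qed

lemma Hb_Gb_zero: "Hb b = 0" "Gb b = 0" "Hb a = A b" "Gb a = D b"
  by (simp_all add: Hb_def Gb_def A_def D_def zero algebra_simps)

text \<open>The flag at the end will be \<open>- T b\<close>, \<open>N b\<close>,
  \<open>- e3\<close>; with these signs all three speeds come out positive again. The middle
  coordinate is \<open>fh b (- t)\<close>.\<close>

lemma reverse:
  "chain (- b) (- a) (\<lambda>t. x b - x (- t)) (\<lambda>t. y b - y (- t)) (\<lambda>t. w b - w (- t))
     (\<lambda>t. f (- t) - f b + y b * (x b - x (- t))) (\<lambda>t. Hb (- t)) (\<lambda>t. Gb (- t))
     (\<lambda>t. x' (- t)) (\<lambda>t. y' (- t)) (\<lambda>t. w' (- t))"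
proof unfold_locales
  have [simp]: "uminus ` {- b..- a} = {a..b}" by simp
  have c: "continuous_on {- b..- a} (\<lambda>t. h (- t))" if "continuous_on {a..b} h" for h :: "real \<Rightarrow> real"
    using that by (intro continuous_on_compose2[OF that]) (auto intro!: continuous_intros)
  show "continuous_on {- b..- a} (\<lambda>t. x b - x (- t))" "continuous_on {- b..- a} (\<lambda>t. y b - y (- t))"
    "continuous_on {- b..- a} (\<lambda>t. w b - w (- t))"
    "continuous_on {- b..- a} (\<lambda>t. f (- t) - f b + y b * (x b - x (- t)))"
    "continuous_on {- b..- a} (\<lambda>t. Hb (- t))" "continuous_on {- b..- a} (\<lambda>t. Gb (- t))"
    unfolding Hb_def Gb_def by (intro continuous_intros c cont)+
  fix t assume "- b < t" "t < - a"
  then have t: "a < - t" "- t < b" by auto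
  show "0 < x' (- t)" "0 < y' (- t)" "0 < w' (- t)" using pos t by auto
  have d: "((\<lambda>t. h (- t)) has_real_derivative - h' (- t)) (at t)"
    if "\<And>t. a < t \<Longrightarrow> t < b \<Longrightarrow> (h has_real_derivative h' t) (at t)" for h h' :: "real \<Rightarrow> real"
    using that[OF t] by (simp add: DERIV_mirror)
  show "((\<lambda>t. x b - x (- t)) has_real_derivative x' (- t)) (at t)"
    "((\<lambda>t. y b - y (- t)) has_real_derivative y' (- t)) (at t)"
    "((\<lambda>t. w b - w (- t)) has_real_derivative w' (- t)) (at t)"
    "((\<lambda>t. f (- t) - f b + y b * (x b - x (- t))) has_real_derivative (y b - y (- t)) * x' (- t)) (at t)"
    "((\<lambda>t. Hb (- t)) has_real_derivative (w b - w (- t)) * y' (- t)) (at t)"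
    "((\<lambda>t. Gb (- t)) has_real_derivative Hb (- t) * x' (- t)) (at t)"
    unfolding Hb_def Gb_def
    by (auto intro!: derivative_eq_intros d der simp: algebra_simps)
qed (use ab in \<open>auto simp: Hb_Gb_zero zero\<close>)

section \<open>Unimodality of the distances to two faces\<close>

text \<open>Rolle supplies one zero of \<open>v\<close>. By \<open>sgn\<close> a non-positive value
  forces negative values afterwards, so \<open>v\<close> is positive before this zero and negative
  after it.\<close>

lemma unimodal_zero_unique:
  fixes h v :: "real \<Rightarrow> real"
  assumes "continuous_on {a..b} h" "h a = 0" "h b = 0"
    and d: "\<And>t. a < t \<Longrightarrow> t < b \<Longrightarrow> (h has_real_derivative x' t * v t) (at t)"
    and sgn: "\<And>s t. a < s \<Longrightarrow> s < t \<Longrightarrow> t < b \<Longrightarrow> v s \<le> 0 \<Longrightarrow> v t < 0"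
  shows "\<exists>c. a < c \<and> c < b \<and> (\<forall>t. a < t \<and> t < b \<longrightarrow> (v t = 0 \<longleftrightarrow> t = c)) \<and>
           (\<forall>t. a \<le> t \<and> t \<le> b \<and> t \<noteq> c \<longrightarrow> h t < h c) \<and> (\<forall>t. a < t \<and> t < b \<longrightarrow> h t > 0)"
proof -
  have hd: "h differentiable (at t)" if "a < t" "t < b" for t
    using d[OF that] real_differentiable_def by blast
  obtain c where c: "a < c" "c < b" "(h has_real_derivative 0) (at c)"
    using Rolle[OF ab _ assms(1) hd] assms(2,3) by auto
  have vc: "v c = 0" using DERIV_unique[OF d[OF c(1,2)] c(3)] pos(1)[OF c(1,2)] by auto
  have v0: "v t > 0" if "a < t" "t < c" for t using sgn[of t c] that c vc by fastforce
  have v1: "v t < 0" if "c < t" "t < b" for t using sgn[of c t] that c vc by auto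
  have inc: "h s < h t" if "a \<le> s" "s < t" "t \<le> c" for s t
    by (rule DERIV_pos_imp_increasing_open[OF that(2)])
      (use that c in \<open>auto intro!: exI[of _ "x' _ * v _"] d v0 pos continuous_on_subset[OF assms(1)] mult_pos_pos\<close>)
  have dec: "h s > h t" if "c \<le> s" "s < t" "t \<le> b" for s t
    by (rule DERIV_neg_imp_decreasing_open[OF that(2)])
      (use that c in \<open>auto intro!: exI[of _ "x' _ * v _"] d v1 pos continuous_on_subset[OF assms(1)] mult_pos_neg\<close>)
  show ?thesis
  proof (intro exI[of _ c] conjI allI impI)
    fix t assume t: "a < t \<and> t < b"
    show "v t = 0 \<longleftrightarrow> t = c" using v0[of t] v1[of t] vc t by force
    show "h t > 0" using inc[of a t] dec[of t b] t assms(2,3) by (cases "t \<le> c") auto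
  next
    fix t assume t: "a \<le> t \<and> t \<le> b \<and> t \<noteq> c"
    show "h t < h c" using inc[of t c] dec[of c t] t c by force
  qed (use c in auto)
qed

text \<open>\<open>S\<close> and \<open>U\<close> are multiples of the distances to the planes \<open>r0 r1 r3\<close> and \<open>r0 r2 r3\<close>.\<close>
definition "S t = f t * g b - g t * f b"
definition "U t = x t * P b - f t * Q b + g t * R b"
text \<open>Chosen so that \<open>U' = x' V\<close>: the functional behind \<open>U\<close>, applied
  to the tangent \<open>T t\<close>.\<close>

definition "V t = P b - y t * Q b + p t * R b"

text \<open>The factor \<open>y t * g b - p t * f b\<close> has the sign of
  \<open>g b / f b - p t / y t\<close>, which changes at most once by
  \<open>py_less\<close>.\<close>

lemma S_unimodal:
  "\<exists>c. a < c \<and> c < b \<and> (\<forall>t. a < t \<and> t < b \<longrightarrow> (y t * g b - p t * f b = 0 \<longleftrightarrow> t = c)) \<and>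
           (\<forall>t. a \<le> t \<and> t \<le> b \<and> t \<noteq> c \<longrightarrow> S t < S c) \<and> (\<forall>t. a < t \<and> t < b \<longrightarrow> S t > 0)"
proof (rule unimodal_zero_unique)
  show "continuous_on {a..b} S" unfolding S_def by (intro continuous_intros cont)
  fix t assume "a < t" "t < b"
  then show "(S has_real_derivative x' t * (y t * g b - p t * f b)) (at t)"
    unfolding S_def by (auto intro!: derivative_eq_intros der simp: algebra_simps)
next
  fix s t assume st: "a < s" "s < t" "t < b" "y s * g b - p s * f b \<le> 0"
  have pos': "y s > 0" "y t > 0" "f b > 0" using pos_coord pos_f st ab by auto
  then have "g b / f b \<le> p s / y s" using st by (simp add: field_simps)
  also have "\<dots> < p t / y t" using py_less st by simp
  finally show "y t * g b - p t * f b < 0" using pos' by (simp add: field_simps)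
qed (simp_all add: S_def zero)

text \<open>Geometrically, the tangent at \<open>b\<close> lies in the plane r0 r2 r3.\<close>

lemma V_b: "V b = 0" by (simp add: V_def P_def Q_def R_def algebra_simps)

lemma der_V: "a < t \<Longrightarrow> t < b \<Longrightarrow> (V has_real_derivative y' t * (w t * R b - Q b)) (at t)"
  unfolding V_def by (auto intro!: derivative_eq_intros der simp: algebra_simps)

lemma cont_V: "continuous_on {a..b} V"
  unfolding V_def by (intro continuous_intros cont)

text \<open>Since \<open>w\<close> increases, \<open>V\<close> can only switch from falling to
  rising, and it ends at \<open>V b = 0\<close>. If \<open>V s\<close> is non-positive, then at a
  later \<open>t\<close> the function is either still falling from \<open>V s\<close> or already
  rising towards 0; both give a negative value.\<close>

lemma U_unimodal:
  "\<exists>c. a < c \<and> c < b \<and> (\<forall>t. a < t \<and> t < b \<longrightarrow> (V t = 0 \<longleftrightarrow> t = c)) \<and>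
           (\<forall>t. a \<le> t \<and> t \<le> b \<and> t \<noteq> c \<longrightarrow> U t < U c) \<and> (\<forall>t. a < t \<and> t < b \<longrightarrow> U t > 0)"
proof (rule unimodal_zero_unique)
  show "continuous_on {a..b} U" unfolding U_def by (intro continuous_intros cont)
  fix t assume "a < t" "t < b"
  then show "(U has_real_derivative x' t * V t) (at t)"
    unfolding U_def V_def by (auto intro!: derivative_eq_intros der simp: algebra_simps)
next
  fix s t assume st: "a < s" "s < t" "t < b" "V s \<le> 0"
  have Rb: "R b > 0" using pos_R ab by simp
  have wm: "w z1 < w z2" if "a \<le> z1" "z1 < z2" "z2 \<le> b" for z1 z2 using hat_pos(3) that by simp
  show "V t < 0"
  proof (cases "w t * R b - Q b \<ge> 0")
    case True
    have "V t < V b"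
    proof (rule DERIV_pos_imp_increasing_open[OF st(3), where f = V])
      fix z assume z: "t < z" "z < b"
      have "w z * R b - Q b > 0" using True wm[of t z] z st Rb
        by (smt (verit) mult_strict_right_mono)
      then show "\<exists>l. (V has_real_derivative l) (at z) \<and> 0 < l"
        using der_V[of z] z st pos(2)[of z] by (intro exI[of _ "y' z * (w z * R b - Q b)"]) auto
    qed (use st in \<open>auto intro: continuous_on_subset[OF cont_V]\<close>)
    then show ?thesis using V_b by simp
  next
    case False
    have "V t < V s"
    proof (rule DERIV_neg_imp_decreasing_open[OF st(2), where f = V])
      fix z assume z: "s < z" "z < t"
      have "w z * R b - Q b < 0" using False wm[of z t] z st Rb
        by (smt (verit) mult_strict_right_mono)
      then show "\<exists>l. (V has_real_derivative l) (at z) \<and> l < 0"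
        using der_V[of z] z st pos(2)[of z]
        by (intro exI[of _ "y' z * (w z * R b - Q b)"]) (auto simp: mult_pos_neg)
    qed (use st in \<open>auto intro: continuous_on_subset[OF cont_V]\<close>)
    then show ?thesis using st by simp
  qed
qed (simp_all add: U_def zero P_def Q_def R_def algebra_simps)

end

section \<open>Planes and tetrahedra\<close>

lemma not_collinear_by_functional:
  fixes a b c m :: "'a::euclidean_space"
  assumes "a \<noteq> b" "m \<bullet> (b - a) = 0" "m \<bullet> (c - a) \<noteq> 0"
  shows "\<not> collinear {a, b, c}"
proof
  assume "collinear {a, b, c}"
  then have "collinear {a, c, b}" by (simp add: insert_commute)
  then obtain u where "c = u *\<^sub>R a + (1 - u) *\<^sub>R b" using assms(1) unfolding collinear_3_expand by auto
  then have "c - a = (1 - u) *\<^sub>R (b - a)" by (simp add: algebra_simps)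
  then show False using assms(2,3) by simp
qed

lemma affine_hull_3_eq_plane:
  fixes a b c n :: "real ^ 3"
  assumes "n \<noteq> 0" "n \<bullet> (b - a) = 0" "n \<bullet> (c - a) = 0" "\<not> collinear {a, b, c}"
  shows "affine hull {a, b, c} = {X. n \<bullet> (X - a) = 0}"
proof -
  have eq: "{X. n \<bullet> (X - a) = 0} = {X. n \<bullet> X = n \<bullet> a}" by (auto simp: inner_diff_right)
  have aff: "affine {X. n \<bullet> X = n \<bullet> a}" by (rule affine_hyperplane)
  have sub: "affine hull {a, b, c} \<subseteq> {X. n \<bullet> X = n \<bullet> a}"
    by (rule hull_minimal) (use assms aff in \<open>auto simp: inner_diff_right\<close>)
  have dim: "aff_dim {X. n \<bullet> X = n \<bullet> a} = 2" using aff_dim_hyperplane[OF assms(1)] by simp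
  have "aff_dim {a, b, c} \<ge> 2" using assms(4) by (simp add: collinear_aff_dim)
  moreover have "aff_dim (affine hull {a, b, c}) \<le> 2" using aff_dim_subset[OF sub] dim by simp
  ultimately have "aff_dim (affine hull {a, b, c}) = 2" by simp
  then show ?thesis unfolding eq using sub dim
    by (intro affine_dim_equal affine_affine_hull aff) auto
qed

lemma plane_Int_line:
  fixes m c u v :: "'a::euclidean_space"
  assumes "m \<bullet> (u - c) \<noteq> m \<bullet> (v - c)"
  shows "{X. m \<bullet> (X - c) = 0} \<inter> affine hull {u, v} =
    {u + (m \<bullet> (u - c) / (m \<bullet> (u - c) - m \<bullet> (v - c))) *\<^sub>R (v - u)}"
proof -
  have *: "m \<bullet> (u + k *\<^sub>R (v - u) - c) = m \<bullet> (u - c) - k * (m \<bullet> (u - c) - m \<bullet> (v - c))" for k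
    by (simp add: inner_diff_right inner_add_right algebra_simps)
  have **: "m \<bullet> (u + k *\<^sub>R (v - u) - c) = 0 \<longleftrightarrow> k = m \<bullet> (u - c) / (m \<bullet> (u - c) - m \<bullet> (v - c))" for k
    unfolding * using assms by (auto simp: field_simps)
  have hull: "affine hull {u, v} = range (\<lambda>k. u + k *\<^sub>R (v - u))"
    by (simp add: affine_hull_2_alt)
  show ?thesis unfolding hull by (auto simp only: ** Int_iff mem_Collect_eq image_iff singleton_iff)
qed

lemma infdist_plane:
  fixes n c X :: "'a::euclidean_space"
  assumes "n \<noteq> 0"
  shows "infdist X {Z. n \<bullet> (Z - c) = 0} = \<bar>n \<bullet> (X - c)\<bar> / norm n"
proof (rule antisym)
  let ?F = "X - (n \<bullet> (X - c) / (n \<bullet> n)) *\<^sub>R n"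
  have "?F \<in> {Z. n \<bullet> (Z - c) = 0}" using assms by (simp add: inner_diff_right)
  then have "infdist X {Z. n \<bullet> (Z - c) = 0} \<le> dist X ?F" by (rule infdist_le)
  also have "\<dots> = \<bar>n \<bullet> (X - c)\<bar> / norm n"
    by (simp add: dist_norm power2_norm_eq_inner[symmetric] power2_eq_square)
  finally show "infdist X {Z. n \<bullet> (Z - c) = 0} \<le> \<bar>n \<bullet> (X - c)\<bar> / norm n" .
next
  have ne: "{Z. n \<bullet> (Z - c) = 0} \<noteq> {}" by (auto intro: exI[of _ c])
  have "\<bar>n \<bullet> (X - c)\<bar> / norm n \<le> dist X Z" if "n \<bullet> (Z - c) = 0" for Z
  proof -
    have "n \<bullet> (X - c) = n \<bullet> (X - Z)" using that by (simp add: inner_diff_right)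
    also have "\<bar>\<dots>\<bar> \<le> norm n * norm (X - Z)" by (rule Cauchy_Schwarz_ineq2)
    finally show ?thesis using assms by (simp add: dist_norm field_simps)
  qed
  then show "\<bar>n \<bullet> (X - c)\<bar> / norm n \<le> infdist X {Z. n \<bullet> (Z - c) = 0}"
    using ne by (auto simp: infdist_notempty intro!: cINF_greatest)
qed

lemma parallel_to_plane_iff:
  "parallel_to_plane v {Z. n \<bullet> (Z - c) = 0} \<longleftrightarrow> n \<bullet> v = 0"
  unfolding parallel_to_plane_def
proof
  show "n \<bullet> v = 0" if "\<exists>a\<in>{Z. n \<bullet> (Z - c) = 0}. a + v \<in> {Z. n \<bullet> (Z - c) = 0}"
    using that by (auto simp: algebra_simps inner_add_right inner_diff_right)
  show "\<exists>a\<in>{Z. n \<bullet> (Z - c) = 0}. a + v \<in> {Z. n \<bullet> (Z - c) = 0}" if "n \<bullet> v = 0"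
    using that by (intro bexI[of _ c]) auto
qed

lemma coplanar_hyperplane:
  fixes S :: "(real ^ 3) set"
  assumes "coplanar S"
  obtains n c where "n \<noteq> 0" "S \<subseteq> {X. n \<bullet> X = c}"
proof -
  obtain u v w where uvw: "S \<subseteq> affine hull {u, v, w}" using assms unfolding coplanar_def by blast
  have "aff_dim S \<le> aff_dim (affine hull {u, v, w})" using aff_dim_subset[OF uvw] .
  also have "\<dots> \<le> int (card {u, v, w}) - 1" using aff_dim_le_card[of "{u, v, w}"] by simp
  also have "\<dots> \<le> 2" by (simp add: card_insert_if)
  finally show ?thesis using aff_lowdim_subset_hyperplane[of S] that by auto
qed

lemma mem_convex_hull_4:
  fixes a b c d :: "'a::real_vector"
  assumes "k0 \<ge> 0" "k1 \<ge> 0" "k2 \<ge> 0" "k3 \<ge> 0" "k0 + k1 + k2 + k3 = 1"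
  shows "k0 *\<^sub>R a + k1 *\<^sub>R b + k2 *\<^sub>R c + k3 *\<^sub>R d \<in> convex hull {a, b, c, d}"
proof -
  let ?C = "convex hull {a, b, c, d}"
  let ?k = "(!) [k0, k1, k2, k3]" and ?v = "(!) [a, b, c, d]"
  have "(\<Sum>i<4. ?k i *\<^sub>R ?v i) \<in> ?C"
  proof (rule convex_sum)
    fix i :: nat assume "i \<in> {..<4}"
    then have "i = 0 \<or> i = 1 \<or> i = 2 \<or> i = 3" by auto
    then show "?k i \<ge> 0" "?v i \<in> ?C" using assms by (auto intro: hull_inc simp: numeral_3_eq_3)
  qed (use assms in \<open>auto simp: eval_nat_numeral\<close>)
  then show ?thesis by (simp add: eval_nat_numeral)
qed

section \<open>Where osculating planes and pencils of planes cut the edges\<close>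

context chain
begin

text \<open>Here the base point moves while \<open>r t\<close> stays fixed. \<open>gh s t\<close> is
  the value at \<open>r t\<close> of the functional of the osculating plane at \<open>s\<close>, and
  that functional turns at rate \<open>w'\<close>.\<close>

lemma der_hat:
  assumes "a < s" "s < b"
  shows "((\<lambda>s. gh s t) has_real_derivative - (w' s * fh s t)) (at s)"
    "((\<lambda>s. ph s t) has_real_derivative - (w' s * (y t - y s))) (at s)"
  unfolding gh_def ph_def fh_def
  by (auto intro!: derivative_eq_intros der assms simp: algebra_simps)

lemma cont_hat: "continuous_on {a..b} (\<lambda>s. gh s t)" "continuous_on {a..b} (\<lambda>s. ph s t)"
  unfolding gh_def ph_def fh_def by (intro continuous_intros cont)+

text \<open>The mirror image of \<open>DA_less\<close>: the osculating plane at \<open>s\<close>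
  meets the tangent at \<open>b\<close> at the parameter \<open>- gh s b / ph s b\<close>. The
  numerator is \<open>w'\<close> times the quantity \<open>P\<close> of a restarted chain, positive
  by \<open>hat_pos\<close>.\<close>

lemma gp_less:
  assumes "a \<le> s" "s < t" "t < b"
  shows "gh t b / ph t b < gh s b / ph s b"
proof -
  have "(- gh s b) / ph s b < (- gh t b) / ph t b"
  proof (rule ratio_less_of_deriv[OF assms(2), where u = "\<lambda>z. - gh z b" and v = "\<lambda>z. ph z b"
        and u' = "\<lambda>z. w' z * fh z b" and v' = "\<lambda>z. - (w' z * (y b - y z))"])
    fix z assume z: "s < z" "z < t"
    show "((\<lambda>z. - gh z b) has_real_derivative w' z * fh z b) (at z)"
      using DERIV_minus[OF der_hat(1)[of z b]] z assms by simp
    show "((\<lambda>z. ph z b) has_real_derivative - (w' z * (y b - y z))) (at z)"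
      using der_hat(2) z assms by simp
    have "0 < w' z * (fh z b * ph z b - (y b - y z) * gh z b)"
      using hat_pos(7)[of z b] pos(3)[of z] z assms by simp
    then show "w' z * fh z b * ph z b - (- gh z b) * (- (w' z * (y b - y z))) > 0"
      by (simp add: algebra_simps)
  qed (use assms hat_pos(5)[of _ b] in
       \<open>auto intro!: continuous_on_minus intro: continuous_on_subset[OF cont_hat(1)] continuous_on_subset[OF cont_hat(2)]\<close>)
  then show ?thesis by simp
qed

lemma hat_a: "gh a t = g t" "ph a t = p t" "fh a t = f t"
  by (simp_all add: gh_def ph_def fh_def zero)

text \<open>Values, up to the factors \<open>A b\<close> and \<open>p b\<close>, of the osculating plane at \<open>t\<close> on the two
  inner vertices.\<close>
definition "O1 t = A t * D b - D t * A b"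
definition "O2 t = A t * Q b - w t * P b - D t * p b"

lemma O1_pos: "a < t \<Longrightarrow> t < b \<Longrightarrow> O1 t > 0"
  using DA_less[of t b] pos_A[of t] pos_A[of b] ab by (simp add: O1_def field_simps)

lemma O2_eq: "O2 t = gh t b * p b - g b * ph t b"
  by (simp add: O2_def gh_def ph_def fh_def A_def D_def P_def Q_def algebra_simps)

lemma O2_neg: "a < t \<Longrightarrow> t < b \<Longrightarrow> O2 t < 0"
  using gp_less[of a t] hat_pos(5)[of t b] pos_p[of b] ab by (simp add: O2_eq hat_a field_simps)

text \<open>The ratio locates the osculating plane on the edge r1 r2. Its derivative is governed by
  the Wronskian of \<open>O1\<close> and \<open>O2\<close>, whose positivity becomes visible once it
  is written with the data \<open>Gb\<close>, \<open>Hb\<close> of the reversed curve.\<close>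

lemma O_ratio_less:
  assumes "a < s" "s < t" "t < b"
  shows "O1 s * p b / (O1 s * p b - O2 s * A b) < O1 t * p b / (O1 t * p b - O2 t * A b)"
proof -
  have "O1 s / (O1 s * p b - O2 s * A b) < O1 t / (O1 t * p b - O2 t * A b)"
  proof (rule ratio_less_of_deriv[OF assms(2), where u = O1 and v = "\<lambda>z. O1 z * p b - O2 z * A b"])
    have c: "continuous_on {a..b} O1" "continuous_on {a..b} O2"
      unfolding O1_def O2_def by (intro continuous_intros cont cont_inv)+
    have sub: "{s..t} \<subseteq> {a..b}" using assms by auto
    show "continuous_on {s..t} O1" "continuous_on {s..t} (\<lambda>z. O1 z * p b - O2 z * A b)"
      by (intro continuous_intros c[THEN continuous_on_subset[OF _ sub]])+
    show "0 < O1 z * p b - O2 z * A b" if "s \<le> z" "z \<le> t" for z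
    proof -
      have "O1 z * p b > 0" "O2 z * A b < 0"
        using O1_pos[of z] O2_neg[of z] pos_p[of b] pos_A[of b] that assms by (auto simp: mult_neg_pos)
      then show ?thesis by simp
    qed
    fix z assume "s < z" "z < t"
    then have z: "a < z" "z < b" using assms by auto
    show d1: "(O1 has_real_derivative w' z * (y z * D b - R z * A b)) (at z)"
      unfolding O1_def by (auto intro!: derivative_eq_intros der_A der_D z simp: algebra_simps)
    have d2: "(O2 has_real_derivative w' z * (y z * Q b - P b - R z * p b)) (at z)"
      unfolding O2_def by (auto intro!: derivative_eq_intros der_A der_D der z simp: algebra_simps)
    show "((\<lambda>z. O1 z * p b - O2 z * A b) has_real_derivative
       w' z * (y z * D b - R z * A b) * p b - w' z * (y z * Q b - P b - R z * p b) * A b) (at z)"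
      by (auto intro!: derivative_eq_intros d1 d2)
    have "w' z * (y z * D b - R z * A b) * (O1 z * p b - O2 z * A b) - O1 z *
      (w' z * (y z * D b - R z * A b) * p b - w' z * (y z * Q b - P b - R z * p b) * A b)
      = w' z * A b * (O1 z * (y z * Q b - P b - R z * p b) - O2 z * (y z * D b - R z * A b))"
      by (simp add: algebra_simps)
    also have "O1 z * (y z * Q b - P b - R z * p b) - O2 z * (y z * D b - R z * A b)
       = p z * D b * P b - P z * (D b * p b - A b * Q b) + A b * P b * (D z - R z * w z)"
      by (simp add: O1_def O2_def A_def[of z] D_def[of z] P_def[of z] R_def[of z] algebra_simps)
    \<comment> \<open>This relation says that r2 lies in the osculating plane at
      \<open>b\<close>.\<close>
    also have "D b * p b - A b * Q b = - w b * P b"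
      by (simp add: A_def D_def P_def Q_def algebra_simps)
    also have "p z * D b * P b - P z * (- w b * P b) + A b * P b * (D z - R z * w z)
        = P b * (p z * Gb z + g z * Hb z)"
      by (simp add: Gb_def Hb_def A_def[of z] D_def[of z] P_def[of z] R_def[of z] algebra_simps)
    finally show "w' z * (y z * D b - R z * A b) * (O1 z * p b - O2 z * A b) - O1 z *
      (w' z * (y z * D b - R z * A b) * p b - w' z * (y z * Q b - P b - R z * p b) * A b) > 0"
      using z pos(3)[of z] pos_A[of b] pos_P[of b] pos_p[of z] pos_g[of z] Hb_Gb_pos[of z] ab
      by (simp add: add_pos_pos)
  qed
  then show ?thesis using pos_p[of b] ab mult_strict_right_mono[of _ _ "p b"] by fastforce
qed

lemma S_pos: "a < t \<Longrightarrow> t < b \<Longrightarrow> S t > 0" using S_unimodal by blast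
lemma U_pos: "a < t \<Longrightarrow> t < b \<Longrightarrow> U t > 0" using U_unimodal by blast

text \<open>The planes through the line r0 r3 form a pencil; \<open>S/U\<close> tells which of them
  contains \<open>r t\<close>.\<close>

lemma SU_less:
  assumes "a < s" "s < t" "t < b"
  shows "S s / U s < S t / U t"
proof (rule ratio_less_of_deriv[OF assms(2)])
  have c: "continuous_on {a..b} S" "continuous_on {a..b} U"
    unfolding S_def U_def by (intro continuous_intros cont)+
  show "continuous_on {s..t} S" "continuous_on {s..t} U"
    using assms by (auto intro: c[THEN continuous_on_subset])
  show "0 < U z" if "s \<le> z" "z \<le> t" for z using U_pos that assms by simp
  fix z assume "s < z" "z < t"
  then have z: "a < z" "z < b" using assms by auto
  show "(S has_real_derivative x' z * (y z * g b - p z * f b)) (at z)"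
    unfolding S_def by (auto intro!: derivative_eq_intros der z simp: algebra_simps)
  show "(U has_real_derivative x' z * V z) (at z)"
    unfolding U_def V_def by (auto intro!: derivative_eq_intros der z simp: algebra_simps)
  have "x' z * (y z * g b - p z * f b) * U z - S z * (x' z * V z)
    = x' z * P b * (D z * fh z b + gh z b * R z)"
    by (simp add: U_def V_def S_def P_def Q_def R_def D_def A_def fh_def gh_def algebra_simps)
  then show "0 < x' z * (y z * g b - p z * f b) * U z - S z * (x' z * V z)"
    using z pos(1)[of z] pos_P[of b] pos_D[of z] pos_R[of z] hat_pos[of z b] ab
    by (simp add: add_pos_pos)
qed

end

section \<open>The associated tetrahedron\<close>

locale frame = chain a b x y w f p g x' y' w'
  for a b x y w f p g x' y' w' +
  fixes r :: "real \<Rightarrow> real ^ 3" and e1 e2 e3 :: "real ^ 3"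
  assumes det: "cross3 e1 e2 \<bullet> e3 \<noteq> 0"
    and rep: "\<And>t. a \<le> t \<Longrightarrow> t \<le> b \<Longrightarrow> r t = r a + x t *\<^sub>R e1 + f t *\<^sub>R e2 + g t *\<^sub>R e3"
begin

definition "T t = e1 + y t *\<^sub>R e2 + p t *\<^sub>R e3"
definition "N t = e2 + w t *\<^sub>R e3"

definition "n1 = (1 / (cross3 e1 e2 \<bullet> e3)) *\<^sub>R cross3 e2 e3"
definition "n2 = (1 / (cross3 e1 e2 \<bullet> e3)) *\<^sub>R cross3 e3 e1"
definition "n3 = (1 / (cross3 e1 e2 \<bullet> e3)) *\<^sub>R cross3 e1 e2"

lemma dual [simp]:
  "n1 \<bullet> e1 = 1" "n1 \<bullet> e2 = 0" "n1 \<bullet> e3 = 0"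
  "n2 \<bullet> e1 = 0" "n2 \<bullet> e2 = 1" "n2 \<bullet> e3 = 0"
  "n3 \<bullet> e1 = 0" "n3 \<bullet> e2 = 0" "n3 \<bullet> e3 = 1"
proof -
  have "cross3 e2 e3 \<bullet> e1 = cross3 e1 e2 \<bullet> e3" "cross3 e3 e1 \<bullet> e2 = cross3 e1 e2 \<bullet> e3"
    using cross_triple[of e1 e2 e3] cross_triple[of e3 e1 e2] by auto
  then show "n1 \<bullet> e1 = 1" "n1 \<bullet> e2 = 0" "n1 \<bullet> e3 = 0"
    "n2 \<bullet> e1 = 0" "n2 \<bullet> e2 = 1" "n2 \<bullet> e3 = 0"
    "n3 \<bullet> e1 = 0" "n3 \<bullet> e2 = 0" "n3 \<bullet> e3 = 1"
    using det by (simp_all add: n1_def n2_def n3_def dot_cross_self inner_commute)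
qed

definition "M t = A t *\<^sub>R n1 - w t *\<^sub>R n2 + n3"

text \<open>Thus \<open>M t\<close> is the binormal up to normalisation. Its value 1 on
  \<open>e3\<close> keeps it nonzero even where the curve is singular.\<close>

lemma cross_T_N: "cross3 (T t) (N t) = (cross3 e1 e2 \<bullet> e3) *\<^sub>R M t"
proof -
  have "cross3 e3 e2 = - cross3 e2 e3" "cross3 e1 e3 = - cross3 e3 e1" by (rule cross_skew)+
  then show ?thesis
    using det by (simp add: T_def N_def M_def A_def n1_def n2_def n3_def cross_add_left cross_add_right
        cross_mult_left cross_mult_right algebra_simps)
qed

lemma T_a: "T a = e1"
  by (simp add: T_def zero)

definition "pt X Y Z = r a + X *\<^sub>R e1 + Y *\<^sub>R e2 + Z *\<^sub>R e3"

lemma dot_pt: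
  "n1 \<bullet> pt X Y Z = n1 \<bullet> r a + X" "n2 \<bullet> pt X Y Z = n2 \<bullet> r a + Y" "n3 \<bullet> pt X Y Z = n3 \<bullet> r a + Z"
  by (simp_all add: pt_def inner_add_right)

lemma dot_T: "n1 \<bullet> T t = 1" "n2 \<bullet> T t = y t" "n3 \<bullet> T t = p t"
  by (simp_all add: T_def inner_add_right)

lemma pt_r: "a \<le> t \<Longrightarrow> t \<le> b \<Longrightarrow> r t = pt (x t) (f t) (g t)"
  unfolding pt_def by (rule rep)

lemma r_a: "r a = pt 0 0 0" by (simp add: pt_def)

text \<open>\<open>vert1 s t\<close> and \<open>vert2 s t\<close> are the vertices \<open>r1\<close> and \<open>r2\<close> of the tetrahedron of \<open>[s, t]\<close>.\<close>
definition "Ah s t = (y t - y s) * (w t - w s) - ph s t"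
definition "Dh s t = (x t - x s) * Ah s t - fh s t * (w t - w s) + gh s t"
definition "vert1 s t = r s + (Dh s t / Ah s t) *\<^sub>R T s"
definition "vert2 s t = r t - (gh s t / ph s t) *\<^sub>R T t"

lemma AD_a: "Ah a t = A t" "Dh a t = D t"
  by (simp_all add: Ah_def Dh_def A_def D_def hat_a zero)

lemma vert1_a: "vert1 a t = pt (D t / A t) 0 0"
  by (simp add: vert1_def AD_a T_a pt_def)

lemma vert2_a:
  assumes "a < t" "t \<le> b"
  shows "vert2 a t = pt (Q t / p t) (P t / p t) 0"
proof -
  \<comment> \<open>\<open>k\<close> is how far to follow the tangent at \<open>t\<close> backwards
    until it reaches the plane of \<open>e1\<close> and \<open>e2\<close> through
    \<open>r a\<close>.\<close>
  define k where "k = g t / p t"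
  have k: "Q t / p t = x t - k" "P t / p t = f t - k * y t" "0 = g t - k * p t"
    using pos_p[OF assms] by (simp_all add: k_def Q_def P_def field_simps)
  have "vert2 a t = pt (x t - k) (f t - k * y t) (g t - k * p t)"
    using assms rep[of t] by (simp add: vert2_def hat_a k_def[symmetric] T_def pt_def algebra_simps)
  then show ?thesis unfolding k(1,2) using k(3) by simp
qed

definition "tet s t = convex hull {r s, vert1 s t, vert2 s t, r t}"

text \<open>Each hypothesis is the inequality of one face, in the order r1 r2 r3, r0 r2 r3, r0 r1
  r3, r0 r1 r2. Dividing a face value by its value at the opposite vertex gives the barycentric
  coordinates \<open>k0\<close> to \<open>k3\<close>.\<close>

lemma pt_in_tet:
  assumes "D b - A b * X + w b * Y - Z \<ge> 0" "X * P b - Y * Q b + Z * R b \<ge> 0"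
    "Y * g b - Z * f b \<ge> 0" "Z \<ge> 0"
  shows "pt X Y Z \<in> tet a b"
proof -
  have pos: "D b > 0" "A b > 0" "P b > 0" "p b > 0" "g b > 0"
    using ab pos_D pos_A pos_P pos_p pos_g by auto
  define k0 k1 k2 k3 where "k0 = (D b - A b * X + w b * Y - Z) / D b"
    and "k1 = A b * (X * P b - Y * Q b + Z * R b) / (P b * D b)"
    and "k2 = p b * (Y * g b - Z * f b) / (P b * g b)" and "k3 = Z / g b"
  note kd = k0_def k1_def k2_def k3_def
  \<comment> \<open>\<open>i1\<close> puts \<open>r b\<close> on the face r0 r2 r3 and
    \<open>i2\<close> puts r2 on the osculating plane at \<open>b\<close>; \<open>i3\<close> clears
    the coefficient of \<open>Z\<close> in the sum of the coordinates.\<close>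
  have i1: "x b * P b - f b * Q b + g b * R b = 0" by (simp add: P_def Q_def R_def algebra_simps)
  have i2: "p b * D b + w b * P b - A b * Q b = 0" by (simp add: P_def Q_def D_def A_def algebra_simps)
  have i3: "A b * R b * g b - p b * f b * D b + P b * D b - P b * g b = 0"
    by (simp add: P_def R_def D_def A_def algebra_simps)
  have "P b * D b * g b * (k0 + k1 + k2 + k3) =
    (D b - A b * X + w b * Y - Z) * P b * g b + A b * (X * P b - Y * Q b + Z * R b) * g b
     + p b * (Y * g b - Z * f b) * D b + Z * P b * D b"
    using pos by (simp add: kd field_simps)
  also have "\<dots> = P b * D b * g b + Y * g b * (p b * D b + w b * P b - A b * Q b)
      + Z * (A b * R b * g b - p b * f b * D b + P b * D b - P b * g b)"
    by (simp add: algebra_simps)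
  finally have sum: "k0 + k1 + k2 + k3 = 1" using pos by (simp add: i2 i3)
  have "P b * g b * (k1 * (D b / A b) + k2 * (Q b / p b) + k3 * x b) =
      (X * P b - Y * Q b + Z * R b) * g b + (Y * g b - Z * f b) * Q b + Z * x b * P b"
    using pos by (simp add: kd field_simps)
  also have "\<dots> = P b * g b * X + Z * (x b * P b - f b * Q b + g b * R b)" by (simp add: algebra_simps)
  finally have X: "k1 * (D b / A b) + k2 * (Q b / p b) + k3 * x b = X" using pos by (simp add: i1)
  have Y: "k2 * (P b / p b) + k3 * f b = Y" using pos by (simp add: kd field_simps)
  have Z: "k3 * g b = Z" using pos by (simp add: kd)
  have "k0 *\<^sub>R r a + k1 *\<^sub>R vert1 a b + k2 *\<^sub>R vert2 a b + k3 *\<^sub>R r b =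
     (k0 + k1 + k2 + k3) *\<^sub>R r a + (k1 * (D b / A b) + k2 * (Q b / p b) + k3 * x b) *\<^sub>R e1
       + (k2 * (P b / p b) + k3 * f b) *\<^sub>R e2 + (k3 * g b) *\<^sub>R e3"
    using ab by (simp add: vert1_a vert2_a pt_r[of b] pt_def algebra_simps)
  also have "\<dots> = pt X Y Z" unfolding sum X Y Z pt_def by simp
  finally have eq: "pt X Y Z = k0 *\<^sub>R r a + k1 *\<^sub>R vert1 a b + k2 *\<^sub>R vert2 a b + k3 *\<^sub>R r b" ..
  show ?thesis unfolding eq tet_def
    by (rule mem_convex_hull_4) (use assms pos sum in \<open>auto simp: kd\<close>)
qed

lemma S_U_ends: "S a = 0" "U a = 0" "S b = 0" "U b = 0"
  by (simp_all add: S_def U_def P_def Q_def R_def zero algebra_simps)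

text \<open>Along the curve the four face values of \<open>pt_in_tet\<close> are \<open>Gb\<close>,
  \<open>U\<close>, \<open>S\<close> and \<open>g\<close>.\<close>

lemma r_in_tet:
  assumes "a \<le> t" "t \<le> b"
  shows "r t \<in> tet a b"
proof -
  have "t = a \<or> t = b \<or> (a < t \<and> t < b)" using assms by auto
  then have "Gb t \<ge> 0 \<and> U t \<ge> 0 \<and> S t \<ge> 0 \<and> g t \<ge> 0"
    using S_pos[of t] U_pos[of t] Hb_Gb_pos[of t] Hb_Gb_zero S_U_ends zero pos_g[of t] pos_D[of b] ab
    by (auto intro: less_imp_le)
  then show ?thesis unfolding pt_r[OF assms]
    by (intro pt_in_tet) (auto simp: Gb_def U_def S_def algebra_simps)
qed

lemma tet_subset_right:
  assumes "a < c" "c \<le> b"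
  shows "tet a c \<subseteq> tet a b"
proof (cases "c = b")
  case False
  then have c: "a < c" "c < b" using assms by auto
  have ps: "A c > 0" "A b > 0" "p c > 0" "g c > 0" "Q c > 0" "Q b > 0" "P c > 0" "P b > 0" "g b > 0" "D c > 0"
    using pos_A pos_p pos_g pos_Q pos_P pos_D c ab by auto
  have v1: "vert1 a c \<in> tet a b" unfolding vert1_a
  proof (rule pt_in_tet)
    have "D c / A c < D b / A b" using DA_less[of c b] c by simp
    then have "A b * (D c / A c) < D b" using ps(2) by (simp add: pos_less_divide_eq mult.commute)
    then show "D b - A b * (D c / A c) + w b * 0 - 0 \<ge> 0" by simp
  qed (use ps in auto)
  have v2: "vert2 a c \<in> tet a b" unfolding vert2_a[OF assms]
  proof (rule pt_in_tet)
    \<comment> \<open>The vertex is \<open>r c\<close> moved back along \<open>T c\<close>: the face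
      value at \<open>r c\<close> is \<open>Gb c\<close>, and the functional of the osculating plane
      at \<open>b\<close> takes the value \<open>Hb c\<close> on \<open>T c\<close>.\<close>
    have "D b - A b * (Q c / p c) + w b * (P c / p c) - 0 = Gb c + g c / p c * Hb c"
      using ps(3) by (simp add: Gb_def Hb_def Q_def P_def field_simps)
    then show "D b - A b * (Q c / p c) + w b * (P c / p c) - 0 \<ge> 0"
      using Hb_Gb_pos[of c] ps(3,4) c by simp
    have "P c / Q c < P b / Q b" using PQ_less[of c b] c by simp
    then have "P c * Q b < P b * Q c" using ps(5,6) by (simp add: field_simps)
    then have "(Q c * P b - P c * Q b) / p c \<ge> 0" using ps(3) by (simp add: mult.commute)
    then show "Q c / p c * P b - P c / p c * Q b + 0 * R b \<ge> 0" by (simp add: diff_divide_distrib)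
  qed (use ps in auto)
  show ?thesis unfolding tet_def[of a c]
    by (rule hull_minimal) (use v1 v2 r_in_tet[of a] r_in_tet[of c] c in \<open>auto simp: tet_def\<close>)
qed simp

lemma restrict_frame:
  assumes "a < c" "c \<le> b"
  shows "frame a c x y w f p g x' y' w' r e1 e2 e3"
proof -
  have hat: "fh a = f" "ph a = p" "gh a = g" by (auto simp: hat_a)
  have "chain a c x y w f p g x' y' w'"
    using shift[of a c] assms by (simp add: zero hat)
  then show ?thesis by (intro frame.intro frame_axioms.intro det rep) (use assms in auto)
qed

lemma shift_frame:
  assumes "a \<le> s" "s < c" "c \<le> b"
  shows "frame s c (\<lambda>t. x t - x s) (\<lambda>t. y t - y s) (\<lambda>t. w t - w s) (fh s) (ph s) (gh s) x' y' w'
     r (T s) (N s) e3"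
proof -
  have "cross3 (T s) (N s) \<bullet> e3 \<noteq> 0"
    unfolding cross_T_N by (simp add: M_def inner_add_left inner_diff_left det)
  moreover have "r t = r s + (x t - x s) *\<^sub>R T s + fh s t *\<^sub>R N s + gh s t *\<^sub>R e3"
    if "s \<le> t" "t \<le> c" for t
    using that assms rep[of s] rep[of t] by (simp add: T_def N_def fh_def gh_def algebra_simps)
  ultimately show ?thesis by (intro frame.intro[OF shift[OF assms]] frame_axioms.intro)
qed

text \<open>Reversing the parametrisation swaps \<open>vert1\<close> and \<open>vert2\<close>.\<close>

lemma reverse_frame:
  "frame (- b) (- a) (\<lambda>t. x b - x (- t)) (\<lambda>t. y b - y (- t)) (\<lambda>t. w b - w (- t))
     (\<lambda>t. f (- t) - f b + y b * (x b - x (- t))) (\<lambda>t. Hb (- t)) (\<lambda>t. Gb (- t))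
     (\<lambda>t. x' (- t)) (\<lambda>t. y' (- t)) (\<lambda>t. w' (- t)) (\<lambda>t. r (- t)) (- T b) (N b) (- e3)"
proof -
  have "cross3 (- T b) (N b) \<bullet> - e3 \<noteq> 0"
    unfolding cross_minus_left cross_T_N by (simp add: M_def inner_add_left inner_diff_left det)
  moreover have "r (- t) = r (- (- b)) + (x b - x (- t)) *\<^sub>R (- T b)
      + (f (- t) - f b + y b * (x b - x (- t))) *\<^sub>R N b + Gb (- t) *\<^sub>R (- e3)"
    if "- b \<le> t" "t \<le> - a" for t
    using that ab rep[of b] rep[of "- t"]
    by (simp add: T_def N_def Gb_def A_def D_def algebra_simps)
  ultimately show ?thesis by (intro frame.intro[OF reverse] frame_axioms.intro)
qed

text \<open>This is \<open>tet_subset_right\<close> for the reversed curve; the tetrahedra agree as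
  sets because only their vertices are renamed.\<close>

lemma tet_subset_left:
  assumes "a \<le> c" "c < b"
  shows "tet c b \<subseteq> tet a b"
proof -
  interpret V: frame "- b" "- a" "\<lambda>t. x b - x (- t)" "\<lambda>t. y b - y (- t)" "\<lambda>t. w b - w (- t)"
     "\<lambda>t. f (- t) - f b + y b * (x b - x (- t))" "\<lambda>t. Hb (- t)" "\<lambda>t. Gb (- t)"
     "\<lambda>t. x' (- t)" "\<lambda>t. y' (- t)" "\<lambda>t. w' (- t)" "\<lambda>t. r (- t)" "- T b" "N b" "- e3"
    by (rule reverse_frame)
  have VT: "V.T (- t) = - T t" for t
    unfolding V.T_def by (simp add: T_def N_def Hb_def A_def algebra_simps)
  have V1: "V.vert1 (- b) (- t) = vert2 t b" for t
  proof -
    have "V.D (- t) = gh t b" "V.A (- t) = ph t b"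
      unfolding V.D_def V.A_def by (simp_all add: gh_def ph_def fh_def Hb_def Gb_def A_def D_def algebra_simps)
    then show ?thesis by (simp add: V.vert1_def V.AD_a V.T_a vert2_def)
  qed
  have V2: "V.vert2 (- b) (- t) = vert1 t b" for t
  proof -
    have "Gb t = Dh t b" "Hb t = Ah t b"
      by (simp_all add: Dh_def Ah_def gh_def ph_def fh_def Hb_def Gb_def A_def D_def algebra_simps)
    then show ?thesis by (simp add: V.vert2_def V.hat_a VT vert1_def)
  qed
  have "V.tet (- b) (- c) \<subseteq> V.tet (- b) (- a)" by (rule V.tet_subset_right) (use assms in auto)
  moreover have "V.tet (- b) (- t) = tet t b" for t
    by (simp add: V.tet_def tet_def V1 V2 insert_commute)
  ultimately show ?thesis by simp
qed

lemma tet_subset: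
  assumes "a \<le> s" "s < t" "t \<le> b"
  shows "tet s t \<subseteq> tet a b"
proof -
  have at: "a < t" using assms by auto
  interpret W: frame a t x y w f p g x' y' w' r e1 e2 e3 by (rule restrict_frame[OF at assms(3)])
  have "tet s t \<subseteq> tet a t" by (rule W.tet_subset_left) (use assms in auto)
  also have "\<dots> \<subseteq> tet a b" by (rule tet_subset_right) (use assms at in auto)
  finally show ?thesis .
qed

end

text \<open>The points in Q6 and Q7 have the form \<open>u + k (v - u)\<close> with vertices
  \<open>u\<close>, \<open>v\<close>; positivity of \<open>k\<close> removes the absolute value from
  the distance.\<close>

lemma strictly_monotone_dist:
  fixes u v :: "real ^ 3"
  assumes "u \<noteq> v" "\<And>t. t \<in> S \<Longrightarrow> k t > 0" "\<And>s t. s \<in> S \<Longrightarrow> t \<in> S \<Longrightarrow> s < t \<Longrightarrow> k s < k t"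
  shows "strictly_monotone_on S (\<lambda>t. dist u (u + k t *\<^sub>R (v - u)))"
proof -
  have "dist u (u + k t *\<^sub>R (v - u)) = k t * dist u v" if "t \<in> S" for t
    using assms(2)[OF that] by (simp add: dist_norm norm_minus_commute)
  then show ?thesis using assms unfolding strictly_monotone_on_def by auto
qed

text \<open>The triple product expansion is used twice: \<open>n\<close> has zero cross product with
  \<open>cross3 e1 e2\<close>, and crossing with \<open>e3\<close> then isolates a nonzero multiple
  of \<open>n\<close>.\<close>

lemma orthogonal_to_basis_imp_zero:
  assumes "cross3 e1 e2 \<bullet> e3 \<noteq> 0" "n \<bullet> e1 = 0" "n \<bullet> e2 = 0" "n \<bullet> e3 = 0"
  shows "n = 0"
proof -
  have "cross3 n (cross3 e1 e2) = 0" using assms by (simp add: Lagrange)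
  then have "(e3 \<bullet> cross3 e1 e2) *\<^sub>R n = 0"
    using Lagrange[of e3 n "cross3 e1 e2"] assms(4) by (simp add: inner_commute)
  then show ?thesis using assms(1) by (simp add: inner_commute)
qed

lemma minus_divide_minus_diff: "- u / (- u - v) = u / (u + v)" for u v :: real
proof -
  have "- u - v = - (u + v)" by simp
  then show ?thesis by (simp only: minus_divide_divide)
qed

lemma frac_less_frac:
  fixes u v u' v' :: real
  assumes "u * v' < u' * v" "u > 0" "v > 0" "u' > 0" "v' > 0"
  shows "u / (u + v) < u' / (u' + v')"
proof -
  have "u + v > 0" "u' + v' > 0" using assms by auto
  then have "u / (u + v) < u' / (u' + v') \<longleftrightarrow> u * (u' + v') < u' * (u + v)"
    by (simp add: divide_less_eq less_divide_eq mult.commute)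
  then show ?thesis using assms(1) by (simp add: algebra_simps)
qed

context chain
begin

text \<open>Up to constant factors, \<open>Gb\<close> and \<open>g\<close> are the distances to the
  final and to the initial osculating plane. One falls and the other grows, which gives
  \<open>p03_monotone\<close>.\<close>

lemma Gb_less:
  assumes "a < s" "s < t" "t < b"
  shows "Gb t < Gb s"
proof (rule DERIV_neg_imp_decreasing_open[OF assms(2), where f = Gb])
  fix z assume "s < z" "z < t"
  then have z: "a < z" "z < b" using assms by auto
  have "(Gb has_real_derivative - (Hb z * x' z)) (at z)"
    unfolding Gb_def Hb_def by (auto intro!: derivative_eq_intros der z simp: algebra_simps)
  then show "\<exists>l. (Gb has_real_derivative l) (at z) \<and> l < 0"
    using Hb_Gb_pos(1)[of z] pos(1)[of z] z by (intro exI[of _ "- (Hb z * x' z)"]) auto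
next
  have "continuous_on {a..b} Gb" unfolding Gb_def by (intro continuous_intros cont)
  then show "continuous_on {s..t} Gb" using assms by (auto elim: continuous_on_subset)
qed

lemma g_less:
  assumes "a < s" "s < t" "t < b"
  shows "g s < g t"
proof -
  have "g t - g s = p s * (x t - x s) + w s * fh s t + gh s t" by (simp add: gh_def)
  moreover have "p s * (x t - x s) > 0" "w s * fh s t > 0" "gh s t > 0"
    using pos_p[of s] pos_coord[of s] hat_pos[of s t] assms by auto
  ultimately show ?thesis by linarith
qed

end

section \<open>Face planes and the intersection points of Q6 and Q7\<close>

context frame
begin

text \<open>\<open>L1\<close> and \<open>L2\<close> cut out the faces r0 r2 r3 and r0 r1 r3;
  together they span the pencil of planes through the line r0 r3.\<close>

definition "L1 = P b *\<^sub>R n1 - Q b *\<^sub>R n2 + R b *\<^sub>R n3"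
definition "L2 = g b *\<^sub>R n2 - f b *\<^sub>R n3"

lemma M_pt: "M t \<bullet> pt X Y Z = M t \<bullet> r a + (A t * X - w t * Y + Z)"
  by (simp add: M_def inner_add_left inner_diff_left dot_pt algebra_simps)

lemma L_pt: "L1 \<bullet> pt X Y Z = L1 \<bullet> r a + (X * P b - Y * Q b + Z * R b)"
  "L2 \<bullet> pt X Y Z = L2 \<bullet> r a + (Y * g b - Z * f b)"
  by (simp_all add: L1_def L2_def inner_add_left inner_diff_left dot_pt algebra_simps)

lemma L_T: "L1 \<bullet> T t = V t" "L2 \<bullet> T t = y t * g b - p t * f b"
  by (simp_all add: L1_def L2_def V_def inner_add_left inner_diff_left dot_T algebra_simps)

lemma functional_nonzero: "M t \<noteq> 0" "L1 \<noteq> 0" "L2 \<noteq> 0"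
proof -
  have "M t \<bullet> e3 = 1" "L1 \<bullet> e1 = P b" "L2 \<bullet> e2 = g b"
    by (simp_all add: M_def L1_def L2_def inner_add_left inner_diff_left)
  then show "M t \<noteq> 0" "L1 \<noteq> 0" "L2 \<noteq> 0" using pos_P[of b] pos_g[of b] ab by auto
qed

abbreviation "v1 \<equiv> vert1 a b"
abbreviation "v2 \<equiv> vert2 a b"

lemmas v1_pt = vert1_a[of b]
lemmas v2_pt = vert2_a[OF ab order_refl]
lemmas rb_pt = pt_r[OF less_imp_le[OF ab] order_refl]

lemma pos_b: "D b > 0" "A b > 0" "P b > 0" "Q b > 0" "R b > 0" "p b > 0" "g b > 0" "f b > 0" "x b > 0"
  using pos_all[of b] ab by auto

lemma M_osc: "a \<le> t \<Longrightarrow> t \<le> b \<Longrightarrow> M t \<bullet> (pt X Y Z - r t) = A t * X - w t * Y + Z - D t"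
  by (simp add: inner_diff_right M_pt pt_r[of t] D_def algebra_simps)

lemma L_pt_diff: "L1 \<bullet> (pt X Y Z - r a) = X * P b - Y * Q b + Z * R b"
  "L2 \<bullet> (pt X Y Z - r a) = Y * g b - Z * f b"
  by (simp_all add: inner_diff_right L_pt)

lemma n_pt_diff: "n1 \<bullet> (pt X Y Z - pt X' Y' Z') = X - X'" "n2 \<bullet> (pt X Y Z - pt X' Y' Z') = Y - Y'"
  "n3 \<bullet> (pt X Y Z - pt X' Y' Z') = Z - Z'"
  by (simp_all add: inner_diff_right dot_pt)

lemma pt_eq_iff: "pt X Y Z = pt X' Y' Z' \<longleftrightarrow> X = X' \<and> Y = Y' \<and> Z = Z'"
proof
  assume "pt X Y Z = pt X' Y' Z'"
  then have "n1 \<bullet> pt X Y Z = n1 \<bullet> pt X' Y' Z'" "n2 \<bullet> pt X Y Z = n2 \<bullet> pt X' Y' Z'"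
    "n3 \<bullet> pt X Y Z = n3 \<bullet> pt X' Y' Z'" by auto
  then show "X = X' \<and> Y = Y' \<and> Z = Z'" by (simp add: dot_pt)
qed simp

lemma verts_neq: "v1 \<noteq> v2" "r a \<noteq> v1" "r a \<noteq> v2" "v2 \<noteq> r b" "r a \<noteq> r b"
  using pos_b unfolding v1_pt v2_pt rb_pt r_a pt_eq_iff by auto

lemma hull_012: "affine hull {r a, v1, v2} = {X. M a \<bullet> (X - r a) = 0}"
proof (rule affine_hull_3_eq_plane[OF functional_nonzero(1)])
  show "\<not> collinear {r a, v1, v2}"
    by (rule not_collinear_by_functional[of _ _ n2]) (use pos_b verts_neq in
      \<open>auto simp: v1_pt v2_pt r_a n_pt_diff\<close>)
qed (use ab pos_b in \<open>auto simp: v1_pt v2_pt M_osc zero_inv zero\<close>)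

lemma M_b_v: "M b \<bullet> (v1 - r b) = 0" "M b \<bullet> (v2 - r b) = 0"
proof -
  show "M b \<bullet> (v1 - r b) = 0" using ab pos_b by (simp add: v1_pt M_osc)
  have "A b * Q b - w b * P b - D b * p b = 0" by (simp add: A_def Q_def P_def D_def algebra_simps)
  then show "M b \<bullet> (v2 - r b) = 0" using ab pos_b by (simp add: v2_pt M_osc field_simps)
qed

lemma hull_123: "affine hull {v1, v2, r b} = {X. M b \<bullet> (X - r b) = 0}"
proof -
  have "affine hull {v1, v2, r b} = {X. M b \<bullet> (X - v1) = 0}"
  proof (rule affine_hull_3_eq_plane[OF functional_nonzero(1)])
    show "\<not> collinear {v1, v2, r b}"
      by (rule not_collinear_by_functional[of _ _ n3]) (use pos_b verts_neq in
        \<open>auto simp: v1_pt v2_pt rb_pt n_pt_diff\<close>)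
  qed (use M_b_v in \<open>auto simp: inner_diff_right\<close>)
  then show ?thesis using M_b_v(1) by (simp add: inner_diff_right)
qed

lemma hull_023: "affine hull {r a, v2, r b} = {X. L1 \<bullet> (X - r a) = 0}"
proof (rule affine_hull_3_eq_plane[OF functional_nonzero(2)])
  show "\<not> collinear {r a, v2, r b}"
    by (rule not_collinear_by_functional[of _ _ n3]) (use pos_b verts_neq in
      \<open>auto simp: v1_pt v2_pt rb_pt r_a n_pt_diff\<close>)
  show "L1 \<bullet> (r b - r a) = 0" using S_U_ends unfolding rb_pt L_pt_diff U_def by simp
qed (use pos_b in \<open>auto simp: v2_pt L_pt_diff\<close>)

lemma hull_013: "affine hull {r a, v1, r b} = {X. L2 \<bullet> (X - r a) = 0}"
proof (rule affine_hull_3_eq_plane[OF functional_nonzero(3)])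
  show "\<not> collinear {r a, v1, r b}"
    by (rule not_collinear_by_functional[of _ _ n3]) (use pos_b verts_neq in
      \<open>auto simp: v1_pt rb_pt r_a n_pt_diff\<close>)
qed (use pos_b in \<open>auto simp: v1_pt rb_pt L_pt_diff\<close>)

lemma not_coplanar: "\<not> coplanar {r a, v1, v2, r b}"
proof
  assume "coplanar {r a, v1, v2, r b}"
  then obtain n c where n: "n \<noteq> 0" "{r a, v1, v2, r b} \<subseteq> {X. n \<bullet> X = c}"
    by (rule coplanar_hyperplane)
  then have "n \<bullet> (v1 - r a) = 0" "n \<bullet> (v2 - r a) = 0" "n \<bullet> (r b - r a) = 0"
    by (auto simp: inner_diff_right)
  \<comment> \<open>The three edge vectors are triangular in \<open>e1\<close>, \<open>e2\<close>,
    \<open>e3\<close> with nonzero diagonal.\<close>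
  then have e: "n \<bullet> e1 = 0" "n \<bullet> e2 = 0" "n \<bullet> e3 = 0"
    using pos_b unfolding v1_pt v2_pt rb_pt pt_def by (auto simp: inner_add_right)
  then show False using n(1) det orthogonal_to_basis_imp_zero by blast
qed

definition "osc_pt u v t = u + (M t \<bullet> (u - r t) / (M t \<bullet> (u - r t) - M t \<bullet> (v - r t))) *\<^sub>R (v - u)"

lemma osc_values:
  assumes "a < t" "t < b"
  shows "M t \<bullet> (r a - r t) = - D t" "M t \<bullet> (v1 - r t) = O1 t / A b"
    "M t \<bullet> (v2 - r t) = O2 t / p b" "M t \<bullet> (r b - r t) = gh t b"
proof -
  show "M t \<bullet> (r a - r t) = - D t" using M_osc[of t 0 0 0] assms by (simp add: r_a)
  show "M t \<bullet> (v1 - r t) = O1 t / A b" using assms pos_b by (simp add: v1_pt M_osc O1_def field_simps)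
  show "M t \<bullet> (v2 - r t) = O2 t / p b" using assms pos_b by (simp add: v2_pt M_osc O2_def field_simps)
  show "M t \<bullet> (r b - r t) = gh t b"
    unfolding rb_pt M_osc[OF less_imp_le[OF assms(1)] less_imp_le[OF assms(2)]]
    by (simp add: gh_def fh_def A_def D_def algebra_simps)
qed

text \<open>The signs alternate along r0, r1, r2, r3, so the osculating plane separates consecutive
  vertices and cuts each of the three edges in an inner point.\<close>

lemma osc_signs:
  assumes "a < t" "t < b"
  shows "M t \<bullet> (r a - r t) < 0" "M t \<bullet> (v1 - r t) > 0" "M t \<bullet> (v2 - r t) < 0" "M t \<bullet> (r b - r t) > 0"
  unfolding osc_values[OF assms]
  using pos_D[of t] O1_pos[of t] O2_neg[of t] hat_pos(6)[of t b] pos_b assms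
  by (auto simp: divide_neg_pos)

lemma osc_Int_edges:
  assumes "a < t" "t < b"
  shows "{X. M t \<bullet> (X - r t) = 0} \<inter> affine hull {r a, v1} = {osc_pt (r a) v1 t}"
    "{X. M t \<bullet> (X - r t) = 0} \<inter> affine hull {v1, v2} = {osc_pt v1 v2 t}"
    "{X. M t \<bullet> (X - r t) = 0} \<inter> affine hull {v2, r b} = {osc_pt v2 (r b) t}"
proof -
  note s = osc_signs[OF assms]
  show "{X. M t \<bullet> (X - r t) = 0} \<inter> affine hull {r a, v1} = {osc_pt (r a) v1 t}"
    "{X. M t \<bullet> (X - r t) = 0} \<inter> affine hull {v1, v2} = {osc_pt v1 v2 t}"
    "{X. M t \<bullet> (X - r t) = 0} \<inter> affine hull {v2, r b} = {osc_pt v2 (r b) t}"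
    unfolding osc_pt_def using s by (intro plane_Int_line; simp)+
qed

lemma osc_monotone:
  "strictly_monotone_on {a<..<b} (\<lambda>t. dist (r a) (osc_pt (r a) v1 t))"
  "strictly_monotone_on {a<..<b} (\<lambda>t. dist v1 (osc_pt v1 v2 t))"
  "strictly_monotone_on {a<..<b} (\<lambda>t. dist v2 (osc_pt v2 (r b) t))"
proof -
  \<comment> \<open>The position on the first edge is \<open>D/A\<close> divided by its value at
    \<open>b\<close>.\<close>
  have k1: "M t \<bullet> (r a - r t) / (M t \<bullet> (r a - r t) - M t \<bullet> (v1 - r t)) = (D t / A t) / (D b / A b)"
    if "a < t" "t < b" for t
    using pos_b pos_A[of t] that by (simp add: osc_values O1_def field_simps)
  show "strictly_monotone_on {a<..<b} (\<lambda>t. dist (r a) (osc_pt (r a) v1 t))"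
    unfolding osc_pt_def
  proof (rule strictly_monotone_dist[OF verts_neq(2)])
    fix s t assume st: "s \<in> {a<..<b}" "t \<in> {a<..<b}" "s < t"
    then have "D s / A s / (D b / A b) < D t / A t / (D b / A b)"
      using DA_less[of s t] pos_b by (intro divide_strict_right_mono) auto
    then show "M s \<bullet> (r a - r s) / (M s \<bullet> (r a - r s) - M s \<bullet> (v1 - r s))
       < M t \<bullet> (r a - r t) / (M t \<bullet> (r a - r t) - M t \<bullet> (v1 - r t))"
      using k1[of s] k1[of t] st by simp
  qed (use k1 pos_D pos_A pos_b in auto)
  have k2: "M t \<bullet> (v1 - r t) / (M t \<bullet> (v1 - r t) - M t \<bullet> (v2 - r t))
      = O1 t * p b / (O1 t * p b - O2 t * A b)"
    if "a < t" "t < b" for t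
  proof -
    have "O1 t / A b - O2 t / p b = (O1 t * p b - O2 t * A b) / (A b * p b)"
      using pos_b by (simp add: field_simps)
    then show ?thesis using pos_b that by (simp add: osc_values)
  qed
  show "strictly_monotone_on {a<..<b} (\<lambda>t. dist v1 (osc_pt v1 v2 t))"
    unfolding osc_pt_def
  proof (rule strictly_monotone_dist[OF verts_neq(1)])
    fix s t assume "s \<in> {a<..<b}" "t \<in> {a<..<b}" "s < t"
    then show "M s \<bullet> (v1 - r s) / (M s \<bullet> (v1 - r s) - M s \<bullet> (v2 - r s))
       < M t \<bullet> (v1 - r t) / (M t \<bullet> (v1 - r t) - M t \<bullet> (v2 - r t))"
      using k2 O_ratio_less[of s t] by simp
  next
    fix t assume "t \<in> {a<..<b}"
    then show "M t \<bullet> (v1 - r t) / (M t \<bullet> (v1 - r t) - M t \<bullet> (v2 - r t)) > 0"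
      using osc_signs(2,3)[of t] by (intro divide_pos_pos) auto
  qed
  \<comment> \<open>Q6 measures from r2 whereas \<open>gp_less\<close> measures from
    \<open>r b\<close>, hence the complement to 1.\<close>
  have k3: "M t \<bullet> (v2 - r t) / (M t \<bullet> (v2 - r t) - M t \<bullet> (r b - r t))
      = 1 - (gh t b / ph t b) / (g b / p b)"
    if "a < t" "t < b" for t
    using pos_b hat_pos[of t b] that by (simp add: osc_values O2_eq field_simps)
  show "strictly_monotone_on {a<..<b} (\<lambda>t. dist v2 (osc_pt v2 (r b) t))"
    unfolding osc_pt_def
  proof (rule strictly_monotone_dist[OF verts_neq(4)])
    fix s t assume st: "s \<in> {a<..<b}" "t \<in> {a<..<b}" "s < t"
    then have "gh t b / ph t b / (g b / p b) < gh s b / ph s b / (g b / p b)"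
      using gp_less[of s t] pos_b by (intro divide_strict_right_mono) auto
    then show "M s \<bullet> (v2 - r s) / (M s \<bullet> (v2 - r s) - M s \<bullet> (r b - r s))
       < M t \<bullet> (v2 - r t) / (M t \<bullet> (v2 - r t) - M t \<bullet> (r b - r t))"
      using k3[of s] k3[of t] st by simp
  next
    fix t assume "t \<in> {a<..<b}"
    then show "M t \<bullet> (v2 - r t) / (M t \<bullet> (v2 - r t) - M t \<bullet> (r b - r t)) > 0"
      using osc_signs(3,4)[of t] by (intro divide_neg_neg) auto
  qed
qed

text \<open>The plane belongs to the pencil through r1 r2 spanned by the two end osculating planes.
  Relative to r1, the functionals \<open>n3\<close> and \<open>M b\<close> take the values
  \<open>g t\<close> and \<open>- Gb t\<close> at \<open>r t\<close>, which dictates the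
  weights.\<close>

lemma plane_12_r:
  assumes "a < t" "t < b"
  shows "affine hull {v1, v2, r t} = {X. (Gb t *\<^sub>R n3 + g t *\<^sub>R M b) \<bullet> (X - v1) = 0}"
    and "\<not> collinear {v1, v2, r t}"
proof -
  have rt: "r t = pt (x t) (f t) (g t)" using assms by (intro pt_r) auto
  have g: "g t > 0" using assms by (simp add: pos_g)
  show nc: "\<not> collinear {v1, v2, r t}"
    by (rule not_collinear_by_functional[of _ _ n3]) (use pos_b verts_neq g in
      \<open>auto simp: v1_pt v2_pt rt n_pt_diff\<close>)
  have M0: "M b \<bullet> (v2 - v1) = 0" using M_b_v by (simp add: inner_diff_right)
  have "M b \<bullet> (r t - r b) = - Gb t" unfolding rt using ab by (simp add: M_osc Gb_def)
  then have M1: "M b \<bullet> (r t - v1) = - Gb t" using M_b_v by (simp add: inner_diff_right)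
  show "affine hull {v1, v2, r t} = {X. (Gb t *\<^sub>R n3 + g t *\<^sub>R M b) \<bullet> (X - v1) = 0}"
  proof (rule affine_hull_3_eq_plane[OF _ _ _ nc])
    have "(Gb t *\<^sub>R n3 + g t *\<^sub>R M b) \<bullet> e1 = g t * A b"
      by (simp add: M_def inner_add_left inner_diff_left)
    then show "Gb t *\<^sub>R n3 + g t *\<^sub>R M b \<noteq> 0" using g pos_b by auto
    have "n3 \<bullet> (v2 - v1) = 0" by (simp add: v1_pt v2_pt n_pt_diff)
    then show "(Gb t *\<^sub>R n3 + g t *\<^sub>R M b) \<bullet> (v2 - v1) = 0" using M0 by (simp add: inner_add_left)
    have "n3 \<bullet> (r t - v1) = g t" by (simp add: v1_pt rt n_pt_diff)
    then show "(Gb t *\<^sub>R n3 + g t *\<^sub>R M b) \<bullet> (r t - v1) = 0" using M1 by (simp add: inner_add_left)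
  qed
qed

definition "p03 t = r a + (g t * D b / (g t * D b + Gb t * g b)) *\<^sub>R (r b - r a)"

lemma plane_12_r_Int:
  assumes "a < t" "t < b"
  shows "affine hull {v1, v2, r t} \<inter> affine hull {r a, r b} = {p03 t}"
proof -
  let ?m = "Gb t *\<^sub>R n3 + g t *\<^sub>R M b"
  have pos: "g t > 0" "Gb t > 0" using assms by (simp_all add: pos_g Hb_Gb_pos)
  have "M b \<bullet> (r a - r b) = - D b" using M_osc[of b 0 0 0] ab by (simp add: r_a)
  then have "M b \<bullet> (r a - v1) = - D b" "M b \<bullet> (r b - v1) = 0"
    using M_b_v(1) by (auto simp: inner_diff_right)
  moreover have "n3 \<bullet> (r a - v1) = 0" "n3 \<bullet> (r b - v1) = g b"
    by (simp_all add: v1_pt r_a rb_pt n_pt_diff)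
  ultimately have m: "?m \<bullet> (r a - v1) = - (g t * D b)" "?m \<bullet> (r b - v1) = Gb t * g b"
    by (simp_all add: inner_add_left)
  have gt: "g t * D b > 0" "Gb t * g b > 0" using pos pos_b by auto
  have "?m \<bullet> (r a - v1) \<noteq> ?m \<bullet> (r b - v1)" unfolding m using gt by linarith
  from plane_Int_line[OF this]
  have "affine hull {v1, v2, r t} \<inter> affine hull {r a, r b} =
     {r a + (- (g t * D b) / (- (g t * D b) - Gb t * g b)) *\<^sub>R (r b - r a)}"
    unfolding plane_12_r(1)[OF assms] m .
  then show ?thesis unfolding p03_def minus_divide_minus_diff .
qed

lemma p03_monotone: "strictly_monotone_on {a<..<b} (\<lambda>t. dist (r a) (p03 t))"
  unfolding p03_def
proof (rule strictly_monotone_dist[OF verts_neq(5)])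
  have pos: "g t > 0" "Gb t > 0" if "t \<in> {a<..<b}" for t using that by (simp_all add: pos_g Hb_Gb_pos)
  show "0 < g t * D b / (g t * D b + Gb t * g b)" if "t \<in> {a<..<b}" for t
    using pos[OF that] pos_b by (simp add: add_pos_pos)
  fix s t assume st: "s \<in> {a<..<b}" "t \<in> {a<..<b}" "s < t"
  have "g s * Gb t < g t * Gb s"
    using g_less[of s t] Gb_less[of s t] pos st by (intro mult_strict_mono) (auto intro: less_imp_le)
  then have "g s * D b * (Gb t * g b) < g t * D b * (Gb s * g b)"
    using pos_b mult_strict_right_mono[of "g s * Gb t" "g t * Gb s" "D b * g b"] by (simp add: algebra_simps)
  then show "g s * D b / (g s * D b + Gb s * g b) < g t * D b / (g t * D b + Gb t * g b)"
    using pos st pos_b by (intro frac_less_frac) auto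
qed

lemma L_values:
  "L1 \<bullet> (v1 - r a) = P b * (D b / A b)" "L2 \<bullet> (v1 - r a) = 0"
  "L1 \<bullet> (v2 - r a) = 0" "L2 \<bullet> (v2 - r a) = g b * (P b / p b)"
  "L1 \<bullet> (r b - r a) = 0" "L2 \<bullet> (r b - r a) = 0"
  "a \<le> t \<Longrightarrow> t \<le> b \<Longrightarrow> L1 \<bullet> (r t - r a) = U t"
  "a \<le> t \<Longrightarrow> t \<le> b \<Longrightarrow> L2 \<bullet> (r t - r a) = S t"
proof -
  show "a \<le> t \<Longrightarrow> t \<le> b \<Longrightarrow> L1 \<bullet> (r t - r a) = U t" "a \<le> t \<Longrightarrow> t \<le> b \<Longrightarrow> L2 \<bullet> (r t - r a) = S t" for t
    using L_pt_diff[of "x t" "f t" "g t"] pt_r[of t] by (auto simp: U_def S_def)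
  from this[of b] show "L1 \<bullet> (r b - r a) = 0" "L2 \<bullet> (r b - r a) = 0" using ab S_U_ends by auto
qed (simp_all add: v1_pt v2_pt L_pt_diff)

definition "q12 t = v1 + (S t * (P b * (D b / A b)) /
   (S t * (P b * (D b / A b)) + U t * (g b * (P b / p b)))) *\<^sub>R (v2 - v1)"

text \<open>The same pencil argument as in \<open>plane_12_r\<close>: relative to
  \<open>r a\<close>, the functionals \<open>L1\<close> and \<open>L2\<close> take the values
  \<open>U t\<close> and \<open>S t\<close> at \<open>r t\<close>.\<close>

lemma plane_03_r:
  assumes "a < t" "t < b"
  shows "affine hull {r a, r b, r t} = {X. (U t *\<^sub>R L2 - S t *\<^sub>R L1) \<bullet> (X - r a) = 0}"
    and "\<not> collinear {r a, r b, r t}"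
    and "affine hull {r a, r b, r t} \<inter> affine hull {v1, v2} = {q12 t}"
proof -
  have ps: "S t > 0" "U t > 0" using S_pos U_pos assms by auto
  let ?m = "U t *\<^sub>R L2 - S t *\<^sub>R L1"
  have lt: "L1 \<bullet> (r t - r a) = U t" "L2 \<bullet> (r t - r a) = S t" using L_values assms by auto
  have m: "?m \<bullet> (v1 - r a) = - (S t * (P b * (D b / A b)))" "?m \<bullet> (v2 - r a) = U t * (g b * (P b / p b))"
    by (simp_all add: inner_diff_left L_values)
  have gt: "S t * (P b * (D b / A b)) > 0" "U t * (g b * (P b / p b)) > 0"
    using ps pos_b by auto
  show nc: "\<not> collinear {r a, r b, r t}"
    by (rule not_collinear_by_functional[of _ _ L2]) (use verts_neq ps in \<open>auto simp: L_values lt\<close>)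
  show hull: "affine hull {r a, r b, r t} = {X. ?m \<bullet> (X - r a) = 0}"
  proof (rule affine_hull_3_eq_plane[OF _ _ _ nc])
    show "?m \<noteq> 0" using m(2) gt(2) by (metis inner_zero_left less_irrefl)
  qed (simp_all add: inner_diff_left L_values lt)
  have "?m \<bullet> (v1 - r a) \<noteq> ?m \<bullet> (v2 - r a)" unfolding m using gt by linarith
  from plane_Int_line[OF this]
  have "affine hull {r a, r b, r t} \<inter> affine hull {v1, v2} = {v1 + (- (S t * (P b * (D b / A b))) /
     (- (S t * (P b * (D b / A b))) - U t * (g b * (P b / p b)))) *\<^sub>R (v2 - v1)}"
    unfolding hull m .
  then show "affine hull {r a, r b, r t} \<inter> affine hull {v1, v2} = {q12 t}"
    unfolding q12_def minus_divide_minus_diff .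
qed

lemma q12_monotone: "strictly_monotone_on {a<..<b} (\<lambda>t. dist v1 (q12 t))"
  unfolding q12_def
proof (rule strictly_monotone_dist[OF verts_neq(1)])
  let ?k = "P b * (D b / A b)" and ?l = "g b * (P b / p b)"
  have ps: "S t > 0" "U t > 0" if "t \<in> {a<..<b}" for t using that by (simp_all add: S_pos U_pos)
  have kl: "?k > 0" "?l > 0" using pos_b by auto
  show "0 < S t * ?k / (S t * ?k + U t * ?l)" if "t \<in> {a<..<b}" for t
    using ps[OF that] pos_b by (intro divide_pos_pos add_pos_pos mult_pos_pos)
  fix s t assume st: "s \<in> {a<..<b}" "t \<in> {a<..<b}" "s < t"
  have "S s / U s < S t / U t" using SU_less st by auto
  then have "S s * U t < S t * U s" using ps[OF st(1)] ps[OF st(2)] by (simp add: field_simps)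
  then have "S s * U t * (?k * ?l) < S t * U s * (?k * ?l)" using mult_strict_right_mono mult_pos_pos[OF kl] by blast
  moreover have "S s * U t * (?k * ?l) = S s * ?k * (U t * ?l)" "S t * U s * (?k * ?l) = S t * ?k * (U s * ?l)"
    by (simp_all only: ac_simps)
  ultimately have "S s * ?k * (U t * ?l) < S t * ?k * (U s * ?l)" by (simp only:)
  then show "S s * ?k / (S s * ?k + U s * ?l) < S t * ?k / (S t * ?k + U t * ?l)"
    using ps[OF st(1)] ps[OF st(2)] pos_b by (intro frac_less_frac mult_pos_pos divide_pos_pos)
qed

end

section \<open>One-sided limits and tetrahedra of subsegments\<close>

text \<open>Agreement of \<open>k\<close> and \<open>h\<close> is asked for only strictly to the
  right of \<open>s\<close>: at a singular point the unit tangent evaluates to 0, while its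
  one-sided limit is the value of the continuous \<open>h\<close>.\<close>

lemma Lim_at_right_continuous_on:
  fixes h :: "real \<Rightarrow> 'a::t2_space"
  assumes "continuous_on {a..b} h" "a \<le> s" "s < b" "\<And>t. s < t \<Longrightarrow> t < b \<Longrightarrow> k t = h t"
  shows "Lim (at_right s) k = h s"
proof (rule tendsto_Lim)
  have "(h \<longlongrightarrow> h s) (at s within {a..b})" using assms by (auto simp: continuous_on_def)
  then have "(h \<longlongrightarrow> h s) (at s within {s..b})" by (rule tendsto_within_subset) (use assms in auto)
  then have "(h \<longlongrightarrow> h s) (at_right s)" using at_within_Icc_at_right[OF assms(3)] by simp
  moreover have "eventually (\<lambda>t. h t = k t) (at_right s)"
    using assms(3,4) by (auto simp: eventually_at_right[OF assms(3)])
  ultimately show "(k \<longlongrightarrow> h s) (at_right s)" by (rule Lim_transform_eventually)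
qed (simp add: trivial_limit_at_right_real)

lemma Lim_at_left_continuous_on:
  fixes h :: "real \<Rightarrow> 'a::t2_space"
  assumes "continuous_on {a..b} h" "a < s" "s \<le> b" "\<And>t. a < t \<Longrightarrow> t < s \<Longrightarrow> k t = h t"
  shows "Lim (at_left s) k = h s"
proof (rule tendsto_Lim)
  have "(h \<longlongrightarrow> h s) (at s within {a..b})" using assms by (auto simp: continuous_on_def)
  then have "(h \<longlongrightarrow> h s) (at s within {a..s})" by (rule tendsto_within_subset) (use assms in auto)
  then have "(h \<longlongrightarrow> h s) (at_left s)" using at_within_Icc_at_left[OF assms(2)] by simp
  moreover have "eventually (\<lambda>t. h t = k t) (at_left s)"
    using assms(2,4) by (auto simp: eventually_at_left[OF assms(2)])
  ultimately show "(k \<longlongrightarrow> h s) (at_left s)" by (rule Lim_transform_eventually)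
qed (simp add: trivial_limit_at_left_real)

context frame
begin

lemma T_nonzero: "T t \<noteq> 0"
  using dot_T(1)[of t] by auto

lemma M_T: "M t \<bullet> T t = 0"
  by (simp add: M_def A_def inner_add_left inner_diff_left dot_T algebra_simps)

lemma tangent_Int_planes:
  "{r a + c *\<^sub>R T a | c. True} \<inter> ({X. M a \<bullet> (X - r a) = 0} \<inter> {X. M b \<bullet> (X - r b) = 0}) = {v1}"
  "{r b + c *\<^sub>R T b | c. True} \<inter> ({X. M a \<bullet> (X - r a) = 0} \<inter> {X. M b \<bullet> (X - r b) = 0}) = {v2}"
proof -
  have line: "{u + c *\<^sub>R v | c. True} \<inter> E = {u + k *\<^sub>R v}"
    if "\<And>c. u + c *\<^sub>R v \<in> E \<longleftrightarrow> c = k" for u v :: "real ^ 3" and E k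
    using that by auto
  have Ma: "M a = n3" by (simp add: M_def zero zero_inv)
  have Mb: "M b \<bullet> (r a + c *\<^sub>R T a - r b) = A b * c - D b" for c
    using M_osc[of b c 0 0] ab by (simp add: T_a pt_def)
  have "M b \<bullet> (r a + c *\<^sub>R T a - r b) = 0 \<longleftrightarrow> c = Dh a b / Ah a b" for c
    unfolding Mb AD_a using pos_b(2) by (auto simp: field_simps)
  then show "{r a + c *\<^sub>R T a | c. True} \<inter> ({X. M a \<bullet> (X - r a) = 0} \<inter> {X. M b \<bullet> (X - r b) = 0}) = {v1}"
    unfolding vert1_def by (intro line) (simp add: M_T)
  have n3: "n3 \<bullet> (r b + c *\<^sub>R T b - r a) = g b + c * p b" for c
    unfolding rb_pt by (simp add: inner_diff_right inner_add_right dot_pt dot_T)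
  have "M a \<bullet> (r b + c *\<^sub>R T b - r a) = 0 \<longleftrightarrow> c = - (g b / p b)" for c
    unfolding Ma n3 using pos_b(6) by (auto simp: field_simps)
  then have "{r b + c *\<^sub>R T b | c. True} \<inter> ({X. M a \<bullet> (X - r a) = 0} \<inter> {X. M b \<bullet> (X - r b) = 0})
      = {r b + (- (g b / p b)) *\<^sub>R T b}"
    by (intro line) (simp add: M_T)
  then show "{r b + c *\<^sub>R T b | c. True} \<inter> ({X. M a \<bullet> (X - r a) = 0} \<inter> {X. M b \<bullet> (X - r b) = 0}) = {v2}"
    by (simp add: vert2_def hat_a)
qed

text \<open>The case of the full segment applies to the chain restarted at \<open>s\<close>, because
  \<open>T\<close>, \<open>M\<close> and the vertices are the same in the flag at
  \<open>s\<close>.\<close>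

lemma tangent_Int_planes_sub:
  assumes "a \<le> s" "s < t" "t \<le> b"
  shows "{r s + c *\<^sub>R T s | c. True} \<inter> ({X. M s \<bullet> (X - r s) = 0} \<inter> {X. M t \<bullet> (X - r t) = 0}) = {vert1 s t}"
    "{r t + c *\<^sub>R T t | c. True} \<inter> ({X. M s \<bullet> (X - r s) = 0} \<inter> {X. M t \<bullet> (X - r t) = 0}) = {vert2 s t}"
    "vert1 s t \<noteq> vert2 s t"
proof -
  interpret H: frame s t "\<lambda>z. x z - x s" "\<lambda>z. y z - y s" "\<lambda>z. w z - w s" "fh s" "ph s" "gh s"
    x' y' w' r "T s" "N s" e3
    by (rule shift_frame[OF assms])
  have HT: "H.T z = T z" for z unfolding H.T_def by (simp add: T_def N_def ph_def algebra_simps)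
  have HN: "H.N z = N z" for z unfolding H.N_def by (simp add: N_def algebra_simps)
  have "cross3 (T s) (N s) \<bullet> e3 = cross3 e1 e2 \<bullet> e3"
    unfolding cross_T_N by (simp add: M_def inner_add_left inner_diff_left)
  then have HM: "H.M z = M z" for z
    using H.cross_T_N[of z] det unfolding HT HN cross_T_N by simp
  have v: "H.vert1 s t = vert1 s t" "H.vert2 s t = vert2 s t"
    unfolding H.vert1_def H.vert2_def vert1_def vert2_def HT H.hat_a H.AD_a
    by (simp_all add: H.A_def H.D_def Ah_def Dh_def)
  show "{r s + c *\<^sub>R T s | c. True} \<inter> ({X. M s \<bullet> (X - r s) = 0} \<inter> {X. M t \<bullet> (X - r t) = 0}) = {vert1 s t}"
    "{r t + c *\<^sub>R T t | c. True} \<inter> ({X. M s \<bullet> (X - r s) = 0} \<inter> {X. M t \<bullet> (X - r t) = 0}) = {vert2 s t}"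
    "vert1 s t \<noteq> vert2 s t"
    using H.tangent_Int_planes H.verts_neq(1) unfolding HT HM v by auto
qed

end

section \<open>Tangents, osculating planes and the eight properties\<close>

text \<open>\<open>d2\<close> and \<open>d3\<close> are nested vector derivatives; computing them
  takes two derivatives of x' and one of y'.\<close>

locale smooth_frame = frame a b x y w f p g x' y' w' r e1 e2 e3
  for a b x y w f p g x' y' w' r e1 e2 e3 +
  fixes x2 x3 y2 :: "real \<Rightarrow> real"
  assumes der2: "\<And>t. a < t \<Longrightarrow> t < b \<Longrightarrow> (x' has_real_derivative x2 t) (at t)"
      "\<And>t. a < t \<Longrightarrow> t < b \<Longrightarrow> (x2 has_real_derivative x3 t) (at t)"
      "\<And>t. a < t \<Longrightarrow> t < b \<Longrightarrow> (y' has_real_derivative y2 t) (at t)"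
begin

lemma vector_derivative_congI:
  assumes "a < t" "t < b" "\<And>s. a < s \<Longrightarrow> s < b \<Longrightarrow> h s = k s" "(k has_vector_derivative k') (at t)"
  shows "vector_derivative h (at t) = k'"
proof (rule vector_derivative_at)
  have "(k has_vector_derivative k') (at t) \<Longrightarrow> (h has_vector_derivative k') (at t)"
    by (rule has_vector_derivative_transform_within_open[of _ _ _ "{a<..<b}"]) (use assms in auto)
  then show "(h has_vector_derivative k') (at t)" using assms(4) by simp
qed

lemma der_T: "a < t \<Longrightarrow> t < b \<Longrightarrow> (T has_vector_derivative y' t *\<^sub>R N t) (at t)"
  unfolding T_def N_def
  by (auto intro!: derivative_eq_intros der simp: algebra_simps)

lemma der_N: "a < t \<Longrightarrow> t < b \<Longrightarrow> (N has_vector_derivative w' t *\<^sub>R e3) (at t)"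
  unfolding N_def by (auto intro!: derivative_eq_intros der)

lemma d1_eq:
  assumes t: "a < t" "t < b"
  shows "d1 r t = x' t *\<^sub>R T t"
  unfolding d1_def
proof (rule vector_derivative_congI[OF t])
  show "r s = r a + x s *\<^sub>R e1 + f s *\<^sub>R e2 + g s *\<^sub>R e3" if "a < s" "s < b" for s
    using that by (intro rep) auto
  show "((\<lambda>s. r a + x s *\<^sub>R e1 + f s *\<^sub>R e2 + g s *\<^sub>R e3) has_vector_derivative x' t *\<^sub>R T t) (at t)"
    by (auto intro!: derivative_eq_intros der t simp: T_def algebra_simps)
qed

lemma d2_eq: "a < t \<Longrightarrow> t < b \<Longrightarrow> d2 r t = x2 t *\<^sub>R T t + (x' t * y' t) *\<^sub>R N t"
  unfolding d2_def
  by (rule vector_derivative_congI[where k = "\<lambda>t. x' t *\<^sub>R T t"])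
    (auto simp: d1_eq intro!: derivative_eq_intros der_T der2)

lemma d3_eq: "a < t \<Longrightarrow> t < b \<Longrightarrow>
    d3 r t = x3 t *\<^sub>R T t + (x2 t * y' t + (x2 t * y' t + x' t * y2 t)) *\<^sub>R N t + (x' t * y' t * w' t) *\<^sub>R e3"
  unfolding d3_def
  by (rule vector_derivative_congI[where k = "\<lambda>t. x2 t *\<^sub>R T t + (x' t * y' t) *\<^sub>R N t"])
    (auto simp: d2_eq vec_eq_iff algebra_simps intro!: derivative_eq_intros der_T der_N der2)

lemma cross_d1_d2: "a < t \<Longrightarrow> t < b \<Longrightarrow>
    cross3 (d1 r t) (d2 r t) = (x' t * x' t * y' t * (cross3 e1 e2 \<bullet> e3)) *\<^sub>R M t"
  by (simp add: d1_eq d2_eq cross_add_right cross_mult_left cross_mult_right cross_T_N)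

text \<open>\<open>M\<close> annihilates \<open>T\<close> and \<open>N\<close>, so only the
  \<open>e3\<close> component of r''' enters the torsion; the triple product is
  \<open>x'^3 y'^2 w'\<close> times that of the flag.\<close>

lemma regular:
  assumes "a < t" "t < b"
  shows "d1 r t \<noteq> 0" "curvature r t \<noteq> 0" "torsion r t \<noteq> 0"
proof -
  note ps = pos[OF assms]
  show d1: "d1 r t \<noteq> 0" using ps T_nonzero by (simp add: d1_eq[OF assms])
  have c: "cross3 (d1 r t) (d2 r t) \<noteq> 0"
    using ps det functional_nonzero(1) by (simp add: cross_d1_d2[OF assms])
  then show "curvature r t \<noteq> 0" using d1 by (simp add: curvature_def)
  have MN: "M t \<bullet> N t = 0" "M t \<bullet> e3 = 1"
    by (simp_all add: M_def N_def inner_add_left inner_diff_left inner_add_right)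
  have "cross3 (d1 r t) (d2 r t) \<bullet> d3 r t =
     x' t * x' t * y' t * (cross3 e1 e2 \<bullet> e3) * (x' t * y' t * w' t)"
    unfolding cross_d1_d2[OF assms] d3_eq[OF assms]
    by (simp add: inner_add_right M_T MN)
  then have "cross3 (d1 r t) (d2 r t) \<bullet> d3 r t \<noteq> 0" using ps det by simp
  then show "torsion r t \<noteq> 0" using c by (simp add: torsion_def)
qed

lemma unit_tangent_eq: "a < t \<Longrightarrow> t < b \<Longrightarrow> unit_tangent r t = (1 / norm (T t)) *\<^sub>R T t"
  using pos(1)[of t] by (simp add: unit_tangent_def d1_eq)

text \<open>The orientation of the flag enters only as a constant sign, so the right-hand side is
  continuous up to the endpoints.\<close>

lemma unit_binormal_eq: "a < t \<Longrightarrow> t < b \<Longrightarrow>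
    unit_binormal r t = (sgn (cross3 e1 e2 \<bullet> e3) / norm (M t)) *\<^sub>R M t"
  using pos[of t] by (simp add: unit_binormal_def cross_d1_d2 abs_mult real_sgn_eq)

lemma cont_T: "continuous_on {a..b} (\<lambda>t. (1 / norm (T t)) *\<^sub>R T t)"
proof -
  have "continuous_on {a..b} T" unfolding T_def by (intro continuous_intros cont)
  then show ?thesis by (intro continuous_intros) (auto simp: T_nonzero)
qed

lemma cont_M: "continuous_on {a..b} (\<lambda>t. (sgn (cross3 e1 e2 \<bullet> e3) / norm (M t)) *\<^sub>R M t)"
proof -
  have "continuous_on {a..b} M" unfolding M_def by (intro continuous_intros cont cont_inv)
  then show ?thesis by (intro continuous_intros) (auto simp: functional_nonzero)
qed

lemma tangent_plus_eq: "a \<le> s \<Longrightarrow> s < b \<Longrightarrow> tangent_plus r s = (1 / norm (T s)) *\<^sub>R T s"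
  unfolding tangent_plus_def by (rule Lim_at_right_continuous_on[OF cont_T]) (auto simp: unit_tangent_eq)

lemma tangent_minus_eq: "a < s \<Longrightarrow> s \<le> b \<Longrightarrow> tangent_minus r s = (1 / norm (T s)) *\<^sub>R T s"
  unfolding tangent_minus_def by (rule Lim_at_left_continuous_on[OF cont_T]) (auto simp: unit_tangent_eq)

lemma line_scale:
  fixes u v :: "real ^ 3"
  assumes "v \<noteq> 0"
  shows "{u + c *\<^sub>R (1 / norm v) *\<^sub>R v | c. True} = {u + c *\<^sub>R v | c. True}"
proof -
  have "u + c *\<^sub>R v = u + (c * norm v) *\<^sub>R (1 / norm v) *\<^sub>R v" for c using assms by simp
  moreover have "u + c *\<^sub>R (1 / norm v) *\<^sub>R v = u + (c / norm v) *\<^sub>R v" for c by simp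
  ultimately show ?thesis by (blast intro: Collect_cong)
qed

lemma tline_eq:
  "a \<le> s \<Longrightarrow> s < b \<Longrightarrow> tline_plus r s = {r s + c *\<^sub>R T s | c. True}"
  "a < s \<Longrightarrow> s \<le> b \<Longrightarrow> tline_minus r s = {r s + c *\<^sub>R T s | c. True}"
  unfolding tline_plus_def tline_minus_def
  by (simp_all only: tangent_plus_eq tangent_minus_eq line_scale[OF T_nonzero])

lemma osc_eq:
  "a < s \<Longrightarrow> s < b \<Longrightarrow> osc r s = {X. M s \<bullet> (X - r s) = 0}"
  "a \<le> s \<Longrightarrow> s < b \<Longrightarrow> osc_plus r s = {X. M s \<bullet> (X - r s) = 0}"
  "a < s \<Longrightarrow> s \<le> b \<Longrightarrow> osc_minus r s = {X. M s \<bullet> (X - r s) = 0}"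
proof -
  have "a \<le> s \<Longrightarrow> s < b \<Longrightarrow> binormal_plus r s = (sgn (cross3 e1 e2 \<bullet> e3) / norm (M s)) *\<^sub>R M s"
    unfolding binormal_plus_def by (rule Lim_at_right_continuous_on[OF cont_M]) (auto simp: unit_binormal_eq)
  moreover have "a < s \<Longrightarrow> s \<le> b \<Longrightarrow> binormal_minus r s = (sgn (cross3 e1 e2 \<bullet> e3) / norm (M s)) *\<^sub>R M s"
    unfolding binormal_minus_def by (rule Lim_at_left_continuous_on[OF cont_M]) (auto simp: unit_binormal_eq)
  ultimately show "a < s \<Longrightarrow> s < b \<Longrightarrow> osc r s = {X. M s \<bullet> (X - r s) = 0}"
    "a \<le> s \<Longrightarrow> s < b \<Longrightarrow> osc_plus r s = {X. M s \<bullet> (X - r s) = 0}"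
    "a < s \<Longrightarrow> s \<le> b \<Longrightarrow> osc_minus r s = {X. M s \<bullet> (X - r s) = 0}"
    using functional_nonzero(1)[of s] det
    by (auto simp: osc_def osc_plus_def osc_minus_def unit_binormal_eq inner_commute sgn_zero_iff)
qed

lemma assoc_tet_sub:
  assumes "a \<le> s" "s < t" "t \<le> b"
  shows "assoc_tet r s t (r s) (vert1 s t) (vert2 s t) (r t)"
  using tangent_Int_planes_sub[OF assms] assms by (simp add: assoc_tet_def tline_eq osc_eq)

text \<open>For non-negative \<open>h\<close> the distance to the plane is \<open>h\<close> over the
  norm of \<open>L\<close>; since the speed is nonzero, parallel points are the zeros of
  \<open>L\<close> on \<open>T t\<close>.\<close>

lemma parallel_farthest:
  assumes "L \<noteq> 0" "\<And>t. a \<le> t \<Longrightarrow> t \<le> b \<Longrightarrow> L \<bullet> (r t - r a) = h t"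
    and c: "a < c" "c < b" "\<And>t. a < t \<Longrightarrow> t < b \<Longrightarrow> L \<bullet> T t = 0 \<longleftrightarrow> t = c"
      "\<And>t. a \<le> t \<Longrightarrow> t \<le> b \<Longrightarrow> t \<noteq> c \<Longrightarrow> h t < h c" "\<And>t. a \<le> t \<Longrightarrow> t \<le> b \<Longrightarrow> h t \<ge> 0"
  shows "parallel_points r a b {X. L \<bullet> (X - r a) = 0} = {r c} \<and>
         farthest_points r a b {X. L \<bullet> (X - r a) = 0} = {r c}"
proof
  have "parallel_to_plane (d1 r t) {X. L \<bullet> (X - r a) = 0} \<longleftrightarrow> t = c" if "a < t" "t < b" for t
    using c(3)[OF that] pos(1)[OF that] by (simp add: parallel_to_plane_iff d1_eq[OF that])
  then show "parallel_points r a b {X. L \<bullet> (X - r a) = 0} = {r c}"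
    using c(1,2) unfolding parallel_points_def by auto
  have inf: "infdist (r t) {X. L \<bullet> (X - r a) = 0} = h t / norm L" if "a \<le> t" "t \<le> b" for t
    using infdist_plane[OF assms(1)] assms(2)[OF that] c(5)[OF that] by simp
  have le: "h t \<le> h c" if "a \<le> t" "t \<le> b" for t using c(4)[OF that] by (cases "t = c") auto
  have L: "norm L > 0" using assms(1) by simp
  show "farthest_points r a b {X. L \<bullet> (X - r a) = 0} = {r c}"
  proof
    show "{r c} \<subseteq> farthest_points r a b {X. L \<bullet> (X - r a) = 0}"
      using c(1,2) le L by (auto simp: farthest_points_def inf divide_right_mono)
    show "farthest_points r a b {X. L \<bullet> (X - r a) = 0} \<subseteq> {r c}"
    proof
      fix X assume "X \<in> farthest_points r a b {X. L \<bullet> (X - r a) = 0}"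
      then obtain t where t: "X = r t" "a \<le> t" "t \<le> b"
        and "infdist (r c) {X. L \<bullet> (X - r a) = 0} \<le> infdist (r t) {X. L \<bullet> (X - r a) = 0}"
        using c(1,2) unfolding farthest_points_def by auto
      then have "h c \<le> h t" using inf[of c] inf[of t] c(1,2) L by (simp add: divide_le_cancel)
      then show "X \<in> {r c}" using c(4)[OF t(2,3)] t(1) by fastforce
    qed
  qed
qed

lemma parallel_farthest_023: "\<exists>q. parallel_points r a b (affine hull {r a, v2, r b}) = {q} \<and>
    farthest_points r a b (affine hull {r a, v2, r b}) = {q}"
proof -
  obtain c where c: "a < c" "c < b" "\<forall>t. a < t \<and> t < b \<longrightarrow> (V t = 0 \<longleftrightarrow> t = c)"
    "\<forall>t. a \<le> t \<and> t \<le> b \<and> t \<noteq> c \<longrightarrow> U t < U c" using U_unimodal by blast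
  have "U t \<ge> 0" if "a \<le> t" "t \<le> b" for t
    using that U_pos[of t] S_U_ends by (cases "t = a"; cases "t = b") auto
  then show ?thesis unfolding hull_023
    using parallel_farthest[OF functional_nonzero(2) L_values(7) c(1,2)] c by (auto simp: L_T)
qed

lemma parallel_farthest_013: "\<exists>q. parallel_points r a b (affine hull {r a, v1, r b}) = {q} \<and>
    farthest_points r a b (affine hull {r a, v1, r b}) = {q}"
proof -
  obtain c where c: "a < c" "c < b" "\<forall>t. a < t \<and> t < b \<longrightarrow> (y t * g b - p t * f b = 0 \<longleftrightarrow> t = c)"
    "\<forall>t. a \<le> t \<and> t \<le> b \<and> t \<noteq> c \<longrightarrow> S t < S c" using S_unimodal by blast
  have "S t \<ge> 0" if "a \<le> t" "t \<le> b" for t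
    using that S_pos[of t] S_U_ends by (cases "t = a"; cases "t = b") auto
  then show ?thesis unfolding hull_013
    using parallel_farthest[OF functional_nonzero(3) L_values(8) c(1,2)] c by (auto simp: L_T)
qed

lemma parallel_tangents:
  "parallel_vec (tangent_plus r a) (v1 - r a)" "parallel_vec (tangent_minus r b) (r b - v2)"
proof -
  have "v1 - r a = (D b / A b) *\<^sub>R T a" "r b - v2 = (g b / p b) *\<^sub>R T b"
    by (simp_all add: vert1_def vert2_def AD_a hat_a)
  then show "parallel_vec (tangent_plus r a) (v1 - r a)" "parallel_vec (tangent_minus r b) (r b - v2)"
    using ab pos_b T_nonzero
    by (simp_all add: parallel_vec_def tangent_plus_eq tangent_minus_eq cross_mult_left cross_mult_right)
qed

theorem quasi_cubic_smooth_frame: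
  assumes "\<And>s t. a < t \<Longrightarrow> t < b \<Longrightarrow> s \<in> I \<Longrightarrow> s \<noteq> t \<Longrightarrow> r s \<noteq> r t"
  shows "quasi_cubic r I a b"
  unfolding quasi_cubic_def
proof (rule conjI[OF ab], rule exI[of _ "r a"], rule exI[of _ v1], rule exI[of _ v2],
    rule exI[of _ "r b"], intro conjI)
  show "assoc_tet r a b (r a) v1 v2 (r b)" using assoc_tet_sub ab by simp
  show "affine hull {r a, v1, v2} = osc_plus r a" "affine hull {v1, v2, r b} = osc_minus r b"
    using ab by (simp_all add: hull_012 hull_123 osc_eq)
  show "r ` {a..b} \<subseteq> convex hull {r a, v1, v2, r b}" using r_in_tet by (auto simp: tet_def)
  show "\<forall>t. a < t \<and> t < b \<longrightarrow> \<not> singular_param r I t \<and> curvature r t \<noteq> 0 \<and> torsion r t \<noteq> 0"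
    using regular assms unfolding singular_param_def by blast
  show "\<forall>s t. a \<le> s \<and> s < t \<and> t \<le> b \<longrightarrow> (\<exists>s0 s1 s2 s3. assoc_tet r s t s0 s1 s2 s3 \<and>
           convex hull {s0, s1, s2, s3} \<subseteq> convex hull {r a, v1, v2, r b})"
    using assoc_tet_sub tet_subset unfolding tet_def by blast
  show "\<exists>p01 p12 p23.
        (\<forall>t. a < t \<and> t < b \<longrightarrow>
           osc r t \<inter> affine hull {r a, v1} = {p01 t} \<and>
           osc r t \<inter> affine hull {v1, v2} = {p12 t} \<and>
           osc r t \<inter> affine hull {v2, r b} = {p23 t}) \<and>
        strictly_monotone_on {a<..<b} (\<lambda>t. dist (r a) (p01 t)) \<and>
        strictly_monotone_on {a<..<b} (\<lambda>t. dist v1 (p12 t)) \<and>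
        strictly_monotone_on {a<..<b} (\<lambda>t. dist v2 (p23 t))"
    using osc_Int_edges osc_monotone
    by (intro exI[of _ "osc_pt (r a) v1"] exI[of _ "osc_pt v1 v2"] exI[of _ "osc_pt v2 (r b)"]) (simp add: osc_eq)
  show "\<exists>p03 q12.
        (\<forall>t. a < t \<and> t < b \<longrightarrow>
           \<not> collinear {v1, v2, r t} \<and> \<not> collinear {r a, r b, r t} \<and>
           affine hull {v1, v2, r t} \<inter> affine hull {r a, r b} = {p03 t} \<and>
           affine hull {r a, r b, r t} \<inter> affine hull {v1, v2} = {q12 t}) \<and>
        strictly_monotone_on {a<..<b} (\<lambda>t. dist (r a) (p03 t)) \<and>
        strictly_monotone_on {a<..<b} (\<lambda>t. dist v1 (q12 t))"
    using plane_12_r(2) plane_12_r_Int plane_03_r(2,3) p03_monotone q12_monotone by blast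
qed (use ab not_coplanar parallel_tangents parallel_farthest_023 parallel_farthest_013 in auto)

end

section \<open>Germs of rational curves\<close>

text \<open>A zero of order exactly \<open>k\<close> with positive leading coefficient. The factored
  form makes the class closed under quotients and, for positive \<open>k\<close>, under
  differentiation, and shows positivity to the right of \<open>c\<close>.\<close>

definition posgerm :: "real \<Rightarrow> nat \<Rightarrow> (real \<Rightarrow> real) \<Rightarrow> bool" where
  "posgerm c k h \<longleftrightarrow> (\<exists>P Q. poly P c > 0 \<and> poly Q c > 0 \<and> h = (\<lambda>t. (t - c) ^ k * (poly P t / poly Q t)))"

lemma eventually_poly_pos:
  fixes P :: "real poly"
  assumes "poly P c > 0"
  shows "eventually (\<lambda>t. poly P t > 0) (nhds c)"
proof -
  have "((\<lambda>t. poly P t) \<longlongrightarrow> poly P c) (nhds c)"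
    using poly_isCont[of c P] by (simp add: continuous_at tendsto_nhds_iff)
  then show ?thesis using assms by (rule order_tendstoD)
qed

lemma DERIV_rational:
  fixes P Q :: "real poly"
  assumes "poly Q t \<noteq> 0"
  shows "((\<lambda>t. poly P t / poly Q t) has_real_derivative
    poly (pderiv P * Q - P * pderiv Q) t / poly (Q * Q) t) (at t)"
  using assms by (auto intro!: derivative_eq_intros)

lemma posgerm_deriv:
  assumes "posgerm c k h" "k > 0"
  obtains h' where "posgerm c (k - 1) h'"
    "eventually (\<lambda>t. (h has_real_derivative h' t) (at t)) (nhds c)"
proof -
  obtain P Q where PQ: "poly P c > 0" "poly Q c > 0" and h: "h = (\<lambda>t. (t - c) ^ k * (poly P t / poly Q t))"
    using assms unfolding posgerm_def by auto
  define P' where "P' = smult (real k) (P * Q) + [:- c, 1:] * (pderiv P * Q - P * pderiv Q)"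
  define h' where "h' = (\<lambda>t. (t - c) ^ (k - 1) * (poly P' t / poly (Q * Q) t))"
  \<comment> \<open>At \<open>c\<close> the second summand of \<open>P'\<close> vanishes, leaving
    \<open>k\<close> times a positive number.\<close>
  have "poly P' c > 0" using PQ assms(2) by (simp add: P'_def)
  then have "posgerm c (k - 1) h'" unfolding posgerm_def h'_def using PQ by (intro exI[of _ P'] exI[of _ "Q * Q"]) simp
  moreover have "(h has_real_derivative h' t) (at t)" if "poly Q t > 0" for t
  proof -
    obtain j where k: "k = Suc j" using assms(2) by (cases k) auto
    have "(h has_real_derivative real k * (t - c) ^ (k - 1) * (poly P t / poly Q t) +
      (t - c) ^ k * (poly (pderiv P * Q - P * pderiv Q) t / poly (Q * Q) t)) (at t)"
    proof -
      have "((\<lambda>t. (t - c) ^ k) has_real_derivative real k * (t - c) ^ (k - 1)) (at t)"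
        by (auto intro!: derivative_eq_intros)
      from DERIV_mult[OF this DERIV_rational[of Q t P]] that show ?thesis
        unfolding h by (simp only: mult.commute less_irrefl)
    qed
    moreover have "real k * (t - c) ^ (k - 1) * (poly P t / poly Q t) +
      (t - c) ^ k * (poly (pderiv P * Q - P * pderiv Q) t / poly (Q * Q) t) = h' t"
      using that by (simp add: h'_def P'_def k field_simps)
    ultimately show ?thesis by simp
  qed
  then have "eventually (\<lambda>t. (h has_real_derivative h' t) (at t)) (nhds c)"
    using eventually_poly_pos[OF PQ(2)] by (auto elim: eventually_mono)
  ultimately show ?thesis using that by blast
qed

text \<open>At order 0 the sign of a derivative is no longer controlled; for the extra derivatives
  of \<open>smooth_frame\<close>, differentiability suffices.\<close>

lemma posgerm_deriv2:
  assumes "posgerm c k h"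
  obtains h' h'' where "eventually (\<lambda>t. (h has_real_derivative h' t) (at t) \<and>
     (h' has_real_derivative h'' t) (at t)) (nhds c)"
proof -
  obtain P Q where PQ: "poly P c > 0" "poly Q c > 0" and "h = (\<lambda>t. (t - c) ^ k * (poly P t / poly Q t))"
    using assms unfolding posgerm_def by auto
  then have h: "h = (\<lambda>t. poly ([:- c, 1:] ^ k * P) t / poly Q t)" by auto
  let ?P = "[:- c, 1:] ^ k * P"
  let ?P1 = "pderiv ?P * Q - ?P * pderiv Q"
  let ?P2 = "pderiv ?P1 * (Q * Q) - ?P1 * pderiv (Q * Q)"
  have "eventually (\<lambda>t. (h has_real_derivative poly ?P1 t / poly (Q * Q) t) (at t) \<and>
     ((\<lambda>t. poly ?P1 t / poly (Q * Q) t) has_real_derivative poly ?P2 t / poly (Q * Q * (Q * Q)) t) (at t)) (nhds c)"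
    using eventually_poly_pos[OF PQ(2)]
  proof eventually_elim
    case (elim t)
    then show ?case unfolding h by (intro conjI DERIV_rational) auto
  qed
  then show ?thesis by (rule that)
qed

text \<open>The product form stays valid at \<open>c\<close>, where \<open>h2\<close> may
  vanish.\<close>

lemma posgerm_quotient:
  assumes "posgerm c k h" "posgerm c j h2" "j \<le> k"
  obtains q where "posgerm c (k - j) q" "eventually (\<lambda>t. h t = q t * h2 t) (nhds c)"
proof -
  obtain P Q where PQ: "poly P c > 0" "poly Q c > 0" and h: "h = (\<lambda>t. (t - c) ^ k * (poly P t / poly Q t))"
    using assms(1) unfolding posgerm_def by auto
  obtain P2 Q2 where PQ2: "poly P2 c > 0" "poly Q2 c > 0" and h2: "h2 = (\<lambda>t. (t - c) ^ j * (poly P2 t / poly Q2 t))"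
    using assms(2) unfolding posgerm_def by auto
  define q where "q = (\<lambda>t. (t - c) ^ (k - j) * (poly (P * Q2) t / poly (Q * P2) t))"
  have "posgerm c (k - j) q" unfolding posgerm_def q_def using PQ PQ2
    by (intro exI[of _ "P * Q2"] exI[of _ "Q * P2"]) simp
  moreover have "eventually (\<lambda>t. h t = q t * h2 t) (nhds c)"
    using eventually_poly_pos[OF PQ(2)] eventually_poly_pos[OF PQ2(1)] eventually_poly_pos[OF PQ2(2)]
  proof eventually_elim
    case (elim t)
    have "(t - c) ^ k = (t - c) ^ (k - j) * (t - c) ^ j" using assms(3) by (simp flip: power_add)
    then show ?case using elim by (simp add: h h2 q_def)
  qed
  ultimately show ?thesis using that by blast
qed

lemma posgerm_pos:
  assumes "posgerm c k h"
  shows "eventually (\<lambda>t. c < t \<longrightarrow> h t > 0) (nhds c)"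
proof -
  obtain P Q where PQ: "poly P c > 0" "poly Q c > 0" and h: "h = (\<lambda>t. (t - c) ^ k * (poly P t / poly Q t))"
    using assms unfolding posgerm_def by auto
  show ?thesis using eventually_poly_pos[OF PQ(1)] eventually_poly_pos[OF PQ(2)]
    by eventually_elim (simp add: h)
qed

lemma posgerm_cont:
  assumes "posgerm c k h"
  shows "eventually (\<lambda>t. isCont h t) (nhds c)"
proof -
  obtain h' h'' where "eventually (\<lambda>t. (h has_real_derivative h' t) (at t) \<and>
     (h' has_real_derivative h'' t) (at t)) (nhds c)" using posgerm_deriv2[OF assms] .
  then show ?thesis by eventually_elim (auto intro: DERIV_isCont)
qed

lemma posgerm_zero: "posgerm c k h \<Longrightarrow> k > 0 \<Longrightarrow> h c = 0"
  unfolding posgerm_def by auto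

text \<open>The orders of \<open>y\<close>, \<open>p\<close>, \<open>w\<close> are
  \<open>k2 - k1\<close>, \<open>k3 - k1\<close>, \<open>k3 - k2\<close>. All are positive, so these
  germs vanish at \<open>c\<close> and their derivatives are again positive germs.\<close>

lemma posgerm_chain:
  assumes x: "posgerm c k1 x" and f: "posgerm c k2 f" and g: "posgerm c k3 g"
    and k: "0 < k1" "k1 < k2" "k2 < k3"
  obtains y w p x' y' w' x2 x3 y2 \<delta> where "\<delta> > 0"
    "\<And>b. c < b \<Longrightarrow> b < c + \<delta> \<Longrightarrow> chain c b x y w f p g x' y' w'"
    "\<And>t. c < t \<Longrightarrow> t < c + \<delta> \<Longrightarrow> (x' has_real_derivative x2 t) (at t)"
    "\<And>t. c < t \<Longrightarrow> t < c + \<delta> \<Longrightarrow> (x2 has_real_derivative x3 t) (at t)"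
    "\<And>t. c < t \<Longrightarrow> t < c + \<delta> \<Longrightarrow> (y' has_real_derivative y2 t) (at t)"
proof -
  obtain x' where x': "posgerm c (k1 - 1) x'" "eventually (\<lambda>t. (x has_real_derivative x' t) (at t)) (nhds c)"
    using posgerm_deriv[OF x] k by auto
  obtain f' where f': "posgerm c (k2 - 1) f'" "eventually (\<lambda>t. (f has_real_derivative f' t) (at t)) (nhds c)"
    using posgerm_deriv[OF f] k by auto
  obtain g' where g': "posgerm c (k3 - 1) g'" "eventually (\<lambda>t. (g has_real_derivative g' t) (at t)) (nhds c)"
    using posgerm_deriv[OF g] k by auto
  obtain y where y: "posgerm c (k2 - k1) y" "eventually (\<lambda>t. f' t = y t * x' t) (nhds c)"
    by (rule posgerm_quotient[OF f'(1) x'(1)]) (use k in auto)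
  obtain p where p: "posgerm c (k3 - k1) p" "eventually (\<lambda>t. g' t = p t * x' t) (nhds c)"
    by (rule posgerm_quotient[OF g'(1) x'(1)]) (use k in auto)
  obtain y' where y': "posgerm c (k2 - k1 - 1) y'" "eventually (\<lambda>t. (y has_real_derivative y' t) (at t)) (nhds c)"
    using posgerm_deriv[OF y(1)] k by auto
  obtain p' where p': "posgerm c (k3 - k1 - 1) p'" "eventually (\<lambda>t. (p has_real_derivative p' t) (at t)) (nhds c)"
    using posgerm_deriv[OF p(1)] k by auto
  obtain w where w: "posgerm c (k3 - k1 - 1 - (k2 - k1 - 1)) w" "eventually (\<lambda>t. p' t = w t * y' t) (nhds c)"
    by (rule posgerm_quotient[OF p'(1) y'(1)]) (use k in auto)
  obtain w' where w': "posgerm c (k3 - k1 - 1 - (k2 - k1 - 1) - 1) w'"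
    "eventually (\<lambda>t. (w has_real_derivative w' t) (at t)) (nhds c)"
    using posgerm_deriv[OF w(1)] k by auto
  obtain x2 x3 where x2: "eventually (\<lambda>t. (x' has_real_derivative x2 t) (at t) \<and> (x2 has_real_derivative x3 t) (at t)) (nhds c)"
    using posgerm_deriv2[OF x'(1)] .
  obtain y2 y3 where y2: "eventually (\<lambda>t. (y' has_real_derivative y2 t) (at t) \<and> (y2 has_real_derivative y3 t) (at t)) (nhds c)"
    using posgerm_deriv2[OF y'(1)] .
  have zero: "x c = 0" "y c = 0" "w c = 0" "f c = 0" "p c = 0" "g c = 0"
    using posgerm_zero[OF x] posgerm_zero[OF y(1)] posgerm_zero[OF w(1)] posgerm_zero[OF f]
      posgerm_zero[OF p(1)] posgerm_zero[OF g] k by auto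
  let ?R = "\<lambda>t. (isCont x t \<and> isCont y t \<and> isCont w t \<and> isCont f t \<and> isCont p t \<and> isCont g t) \<and>
    ((x has_real_derivative x' t) (at t) \<and> (y has_real_derivative y' t) (at t) \<and>
     (w has_real_derivative w' t) (at t) \<and> (f has_real_derivative y t * x' t) (at t) \<and>
     (p has_real_derivative w t * y' t) (at t) \<and> (g has_real_derivative p t * x' t) (at t)) \<and>
    (c < t \<longrightarrow> x' t > 0 \<and> y' t > 0 \<and> w' t > 0) \<and>
    (x' has_real_derivative x2 t) (at t) \<and> (x2 has_real_derivative x3 t) (at t) \<and>
    (y' has_real_derivative y2 t) (at t)"
  have "eventually ?R (nhds c)"
    using posgerm_cont[OF x] posgerm_cont[OF y(1)] posgerm_cont[OF w(1)] posgerm_cont[OF f]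
      posgerm_cont[OF p(1)] posgerm_cont[OF g] x'(2) f'(2) g'(2) y(2) p(2) y'(2) p'(2) w(2) w'(2) x2 y2
      posgerm_pos[OF x'(1)] posgerm_pos[OF y'(1)] posgerm_pos[OF w'(1)]
    by eventually_elim auto
  then obtain \<delta> where \<delta>: "\<delta> > 0" "\<And>t. dist t c < \<delta> \<Longrightarrow> ?R t"
    unfolding eventually_nhds_metric by blast
  then have R: "?R t" if "c \<le> t" "t < c + \<delta>" for t using that by (intro \<delta>(2)) (auto simp: dist_real_def)
  have "chain c b x y w f p g x' y' w'" if "c < b" "b < c + \<delta>" for b
  proof -
    have cont: "continuous_on {c..b} h" if "\<And>t. c \<le> t \<Longrightarrow> t < c + \<delta> \<Longrightarrow> isCont h t" for h :: "real \<Rightarrow> real"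
      using that \<open>b < c + \<delta>\<close> by (auto intro!: continuous_at_imp_continuous_on)
    show ?thesis
      by unfold_locales (use that zero R in \<open>auto intro!: cont\<close>)
  qed
  then show ?thesis using that[of \<delta> y w p x' y' w' x2 x3 y2] \<delta>(1) R by auto
qed

section \<open>A basis adapted to the orders of vanishing\<close>

text \<open>\<open>k\<close> is the ratio of the leading coefficients at \<open>c\<close>. The zero
  polynomial is a separate case because its order carries no information.\<close>

lemma order_cancel:
  fixes P Q :: "real poly"
  assumes "P \<noteq> 0" "Q \<noteq> 0" "order c P = order c Q"
  obtains k where "P - smult k Q = 0 \<or> order c (P - smult k Q) > order c P"
proof -
  let ?n = "order c P"
  obtain P' where P': "P = [:- c, 1:] ^ ?n * P'" using order_decomp[OF assms(1)] by blast
  obtain Q' where Q': "Q = [:- c, 1:] ^ ?n * Q'" "\<not> [:- c, 1:] dvd Q'"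
    using order_decomp[OF assms(2), of c] assms(3) by auto
  define k where "k = poly P' c / poly Q' c"
  have Q0: "poly Q' c \<noteq> 0" using Q'(2) by (simp add: poly_eq_0_iff_dvd)
  have "poly (P' - smult k Q') c = 0" using Q0 by (simp add: k_def)
  then have "[:- c, 1:] dvd P' - smult k Q'" unfolding poly_eq_0_iff_dvd .
  then have "[:- c, 1:] ^ ?n * [:- c, 1:] dvd [:- c, 1:] ^ ?n * (P' - smult k Q')" by (rule mult_dvd_mono[OF dvd_refl])
  also have "[:- c, 1:] ^ ?n * (P' - smult k Q') = P - smult k Q"
    by (subst (2) P', subst Q') (simp add: algebra_simps)
  finally have "[:- c, 1:] ^ Suc ?n dvd P - smult k Q" by (simp add: mult.commute)
  then show ?thesis using that[of k] unfolding order_divides by auto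
qed

lemma max_order:
  fixes h :: "real ^ 3 \<Rightarrow> real poly"
  assumes "E n0" "\<And>n. E n \<Longrightarrow> order c (h n) \<le> B"
  obtains m where "E m" "\<And>n. E n \<Longrightarrow> order c (h n) \<le> order c (h m)"
proof -
  let ?P = "\<lambda>j. \<exists>n. E n \<and> order c (h n) = j"
  have "\<exists>j. ?P j \<and> (\<forall>i. ?P i \<longrightarrow> i \<le> j)"
    using assms by (intro Nat.ex_has_greatest_nat[where P = ?P and k = "order c (h n0)" and b = B]) auto
  then show ?thesis using that by blast
qed

text \<open>A flag adapted to the orders of vanishing: choose \<open>m3\<close>, \<open>m2\<close>, \<open>m1\<close> in turn, each of
  maximal order among the vectors outside the span of the previous ones. The orders strictly
  decrease, since two equal orders could be raised by cancelling leading terms.\<close>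

lemma adapted_basis:
  fixes h :: "real ^ 3 \<Rightarrow> real poly"
  assumes lin: "\<And>n m k. h (n - k *\<^sub>R m) = h n - smult k (h m)"
    and nz: "\<And>n. n \<noteq> 0 \<Longrightarrow> h n \<noteq> 0" and bd: "\<And>n. n \<noteq> 0 \<Longrightarrow> order c (h n) \<le> B"
  obtains m1 m2 m3 where "cross3 m1 m2 \<bullet> m3 \<noteq> 0"
    "order c (h m1) < order c (h m2)" "order c (h m2) < order c (h m3)"
proof -
  obtain m3 where m3: "m3 \<noteq> 0" "\<And>n. n \<noteq> 0 \<Longrightarrow> order c (h n) \<le> order c (h m3)"
    using max_order[of "\<lambda>n. n \<noteq> 0" "axis 1 1" c h B] bd by (auto simp: axis_eq_0_iff)
  obtain m0 where "cross3 m0 m3 \<noteq> 0" using cross_basis_nonzero[OF m3(1)] cross_skew by (metis neg_equal_0_iff_equal)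
  then obtain m2 where m2: "cross3 m2 m3 \<noteq> 0" "\<And>n. cross3 n m3 \<noteq> 0 \<Longrightarrow> order c (h n) \<le> order c (h m2)"
    using max_order[of "\<lambda>n. cross3 n m3 \<noteq> 0" m0 c h B] bd by (metis cross_zero_left)
  \<comment> \<open>The vector \<open>cross3 m2 m3\<close> lies outside the span of
    \<open>m2\<close> and \<open>m3\<close>, so there are candidates for \<open>m1\<close>.\<close>
  have "cross3 (cross3 m2 m3) m2 \<bullet> m3 \<noteq> 0"
    using m2(1) cross_triple[of "cross3 m2 m3" m2 m3] by simp
  then obtain m1 where m1: "cross3 m1 m2 \<bullet> m3 \<noteq> 0"
    "\<And>n. cross3 n m2 \<bullet> m3 \<noteq> 0 \<Longrightarrow> order c (h n) \<le> order c (h m1)"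
    using max_order[of "\<lambda>n. cross3 n m2 \<bullet> m3 \<noteq> 0" "cross3 m2 m3" c h B] bd
    by (metis cross_zero_left inner_zero_left)
  \<comment> \<open>Hence \<open>m1\<close> was already a candidate when \<open>m2\<close> was
    chosen, and its order is at most that of \<open>m2\<close>.\<close>
  have c13: "cross3 m1 m3 \<noteq> 0"
  proof
    assume "cross3 m1 m3 = 0"
    then have "cross3 m3 m1 = 0" using cross_skew by (metis neg_equal_0_iff_equal)
    then show False using m1(1) cross_triple[of m3 m1 m2] by simp
  qed
  have n0: "m2 \<noteq> 0" "m1 \<noteq> 0" using m2(1) c13 by auto
  have "order c (h m2) \<noteq> order c (h m3)"
  proof
    assume eq: "order c (h m2) = order c (h m3)"
    obtain k where k: "h m2 - smult k (h m3) = 0 \<or> order c (h m2 - smult k (h m3)) > order c (h m2)"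
      using order_cancel[OF nz[OF n0(1)] nz[OF m3(1)] eq] .
    have "cross3 (m2 - k *\<^sub>R m3) m3 = cross3 m2 m3" by (simp add: Cross3.left_diff_distrib cross_mult_left)
    then have "m2 - k *\<^sub>R m3 \<noteq> 0" using m2(1) by auto
    then show False using k m3(2)[of "m2 - k *\<^sub>R m3"] nz[of "m2 - k *\<^sub>R m3"] eq by (simp add: lin)
  qed
  moreover have "order c (h m1) \<noteq> order c (h m2)"
  proof
    assume eq: "order c (h m1) = order c (h m2)"
    obtain k where k: "h m1 - smult k (h m2) = 0 \<or> order c (h m1 - smult k (h m2)) > order c (h m1)"
      using order_cancel[OF nz[OF n0(2)] nz[OF n0(1)] eq] .
    have "cross3 (m1 - k *\<^sub>R m2) m2 \<bullet> m3 \<noteq> 0" using m1(1) by (simp add: Cross3.left_diff_distrib cross_mult_left)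
    then have "m1 - k *\<^sub>R m2 \<noteq> 0" "order c (h (m1 - k *\<^sub>R m2)) \<le> order c (h m1)" using m1(2) by auto
    then show False using k nz[of "m1 - k *\<^sub>R m2"] by (simp add: lin)
  qed
  ultimately show ?thesis using that[OF m1(1)] m2(2)[OF c13] m3(2)[OF n0(1)] by (simp add: le_less)
qed

lemma dual_basis:
  fixes m1 m2 m3 :: "real ^ 3"
  assumes "cross3 m1 m2 \<bullet> m3 \<noteq> 0"
  obtains e1 e2 e3 where "cross3 e1 e2 \<bullet> e3 \<noteq> 0"
    "\<And>v. v = (m1 \<bullet> v) *\<^sub>R e1 + (m2 \<bullet> v) *\<^sub>R e2 + (m3 \<bullet> v) *\<^sub>R e3"
proof -
  define d where "d = cross3 m1 m2 \<bullet> m3"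
  define e1 e2 e3 where "e1 = (1 / d) *\<^sub>R cross3 m2 m3" and "e2 = (1 / d) *\<^sub>R cross3 m3 m1"
    and "e3 = (1 / d) *\<^sub>R cross3 m1 m2"
  have d: "d \<noteq> 0" "cross3 m2 m3 \<bullet> m1 = d" "cross3 m3 m1 \<bullet> m2 = d" "cross3 m1 m2 \<bullet> m3 = d"
    using assms cross_triple[of m1 m2 m3] cross_triple[of m3 m1 m2] by (auto simp: d_def)
  have o: "m1 \<bullet> e1 = 1" "m1 \<bullet> e2 = 0" "m1 \<bullet> e3 = 0" "m2 \<bullet> e1 = 0" "m2 \<bullet> e2 = 1" "m2 \<bullet> e3 = 0"
    "m3 \<bullet> e1 = 0" "m3 \<bullet> e2 = 0" "m3 \<bullet> e3 = 1"
    using d by (simp_all add: e1_def e2_def e3_def dot_cross_self inner_commute[of _ "cross3 _ _"])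
  have "cross3 e1 e2 = (1 / d) *\<^sub>R m3"
    using d by (simp add: e1_def e2_def cross_mult_left cross_mult_right Lagrange dot_cross_self)
  then have "cross3 e1 e2 \<bullet> e3 \<noteq> 0" using d(1) o by simp
  moreover have "v = (m1 \<bullet> v) *\<^sub>R e1 + (m2 \<bullet> v) *\<^sub>R e2 + (m3 \<bullet> v) *\<^sub>R e3" for v
  proof -
    have "v - ((m1 \<bullet> v) *\<^sub>R e1 + (m2 \<bullet> v) *\<^sub>R e2 + (m3 \<bullet> v) *\<^sub>R e3) = 0"
      by (rule orthogonal_to_basis_imp_zero[OF assms])
        (simp_all add: inner_commute[of _ m1] inner_commute[of _ m2] inner_commute[of _ m3]
          inner_diff_right inner_add_right o)
    then show ?thesis by simp
  qed
  ultimately show ?thesis using that by blast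
qed

section \<open>From the rational curve to its germs at the base point\<close>

lemma poly_map_poly_complex_of_real:
  "poly (map_poly complex_of_real p) (complex_of_real t) = complex_of_real (poly p t)"
  by (induction p) (auto simp: map_poly_pCons)

lemma rat_curve_c_of_real: "rat_curve_c p q (complex_of_real t) i = complex_of_real (rat_curve p q t $ i)"
  by (simp add: rat_curve_c_def rat_curve_def poly_map_poly_complex_of_real)

text \<open>Only \<open>t\<close> is kept off the finite set of multiple parameters;
  \<open>s\<close> ranges over all of \<open>I\<close>, as \<open>singular_param\<close> demands.
  The point \<open>t0\<close> itself may be multiple, hence \<open>t0 < t\<close>.\<close>

lemma proper_param_eventually_injective:
  assumes "proper_param p q" "\<forall>i. \<forall>t\<in>I. poly (q $ i) t \<noteq> 0"
  obtains \<delta> where "\<delta> > 0" "\<And>s t. t \<in> I \<Longrightarrow> s \<in> I \<Longrightarrow> t0 < t \<Longrightarrow> t < t0 + \<delta> \<Longrightarrow> s \<noteq> t \<Longrightarrow>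
    rat_curve p q s \<noteq> rat_curve p q t"
proof -
  let ?B = "{z. defined_at_c q z \<and> (\<exists>w. w \<noteq> z \<and> defined_at_c q w \<and> rat_curve_c p q w = rat_curve_c p q z)}"
  have "finite (complex_of_real -` ?B)"
    using assms(1) unfolding proper_param_def by (rule finite_vimageI) (simp add: inj_def)
  then obtain \<delta> where \<delta>: "\<delta> > 0" "\<And>t. complex_of_real t \<in> ?B \<Longrightarrow> t \<noteq> t0 \<Longrightarrow> \<delta> \<le> dist t0 t"
    using finite_set_avoid[of "complex_of_real -` ?B" t0] by auto
  have def: "defined_at_c q (complex_of_real t)" if "t \<in> I" for t
    using that assms(2) by (simp add: defined_at_c_def poly_map_poly_complex_of_real)
  have "rat_curve p q s \<noteq> rat_curve p q t"
    if "t \<in> I" "s \<in> I" "t0 < t" "t < t0 + \<delta>" "s \<noteq> t" for s t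
  proof
    assume "rat_curve p q s = rat_curve p q t"
    then have "rat_curve_c p q (complex_of_real s) = rat_curve_c p q (complex_of_real t)"
      by (auto simp: rat_curve_c_of_real)
    then have "complex_of_real t \<in> ?B" using def that by (auto intro!: exI[of _ "complex_of_real s"])
    then show False using \<delta>(2)[of t] that by (auto simp: dist_real_def)
  qed
  then show ?thesis using that \<delta>(1) by blast
qed

text \<open>The inner product of \<open>n\<close> with \<open>r t - r t0\<close>, multiplied by all
  denominators. These do not vanish at \<open>t0\<close>, so the order of vanishing can be read off
  a polynomial that is linear in \<open>n\<close>.\<close>

definition coord_poly :: "real poly ^ 3 \<Rightarrow> real poly ^ 3 \<Rightarrow> real \<Rightarrow> real ^ 3 \<Rightarrow> real poly" where
  "coord_poly p q t0 n = (\<Sum>i\<in>UNIV. smult (n $ i)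
     ((p $ i - smult (rat_curve p q t0 $ i) (q $ i)) * (\<Prod>j\<in>UNIV - {i}. q $ j)))"

lemma coord_poly_eval:
  assumes "\<forall>i. poly (q $ i) t \<noteq> 0"
  shows "poly (coord_poly p q t0 n) t / poly (\<Prod>j\<in>UNIV. q $ j) t = n \<bullet> (rat_curve p q t - rat_curve p q t0)"
proof -
  have "poly (smult (n $ i) ((p $ i - smult (rat_curve p q t0 $ i) (q $ i)) * (\<Prod>j\<in>UNIV - {i}. q $ j))) t
     / poly (\<Prod>j\<in>UNIV. q $ j) t = n $ i * (rat_curve p q t - rat_curve p q t0) $ i" for i
  proof -
    have "(\<Prod>j\<in>UNIV. q $ j) = q $ i * (\<Prod>j\<in>UNIV - {i}. q $ j)" by (rule prod.remove) auto
    moreover have "poly (\<Prod>j\<in>UNIV - {i}. q $ j) t \<noteq> 0" using assms by (simp add: poly_prod)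
    ultimately show ?thesis using assms by (simp add: rat_curve_def field_simps)
  qed
  then show ?thesis unfolding coord_poly_def poly_sum sum_divide_distrib inner_vec_def by simp
qed

lemma coord_poly_linear: "coord_poly p q t0 (n - k *\<^sub>R m) = coord_poly p q t0 n - smult k (coord_poly p q t0 m)"
  by (rule poly_eqI) (simp add: coord_poly_def coeff_sum sum_subtractf[symmetric] sum_distrib_left left_diff_distrib mult.assoc)

lemma coord_poly_nonzero:
  assumes "\<forall>i. \<forall>t\<in>I. poly (q $ i) t \<noteq> 0" "non_planar (rat_curve p q) I" "n \<noteq> 0"
  shows "coord_poly p q t0 n \<noteq> 0"
proof
  assume "coord_poly p q t0 n = 0"
  then have "n \<bullet> rat_curve p q t = n \<bullet> rat_curve p q t0" if "t \<in> I" for t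
    using coord_poly_eval[of q t p t0 n] assms(1) that by (simp add: inner_diff_right)
  then show False using assms(2,3) unfolding non_planar_def by blast
qed

text \<open>The bound is independent of \<open>n\<close>, as the choice of vectors of maximal order
  requires.\<close>

lemma coord_poly_order_bound:
  assumes "coord_poly p q t0 n \<noteq> 0"
  shows "order t0 (coord_poly p q t0 n) \<le>
    (\<Sum>i\<in>UNIV. degree ((p $ i - smult (rat_curve p q t0 $ i) (q $ i)) * (\<Prod>j\<in>UNIV - {i}. q $ j)))"
proof -
  have "degree (coord_poly p q t0 n) \<le>
    (\<Sum>i\<in>UNIV. degree ((p $ i - smult (rat_curve p q t0 $ i) (q $ i)) * (\<Prod>j\<in>UNIV - {i}. q $ j)))"
    unfolding coord_poly_def
    by (intro degree_sum_le order_trans[OF degree_smult_le] member_le_sum) auto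
  then show ?thesis using order_degree[OF assms, of t0] by (rule order_trans[rotated])
qed

lemma coord_posgerm:
  assumes q: "\<forall>i. poly (q $ i) t0 \<noteq> 0" and nz: "coord_poly p q t0 n \<noteq> 0"
  obtains s x where "s \<noteq> 0" "posgerm t0 (order t0 (coord_poly p q t0 n)) x"
    "\<And>t. \<forall>i. poly (q $ i) t \<noteq> 0 \<Longrightarrow> x t = (s *\<^sub>R n) \<bullet> (rat_curve p q t - rat_curve p q t0)"
proof -
  let ?h = "coord_poly p q t0 n" and ?q = "\<Prod>j\<in>UNIV. q $ j"
  let ?k = "order t0 ?h"
  obtain P where P: "?h = [:- t0, 1:] ^ ?k * P" "\<not> [:- t0, 1:] dvd P" using order_decomp[OF nz] by blast
  have P0: "poly P t0 \<noteq> 0" using P(2) by (simp add: poly_eq_0_iff_dvd)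
  have q0: "poly ?q t \<noteq> 0" if "\<forall>i. poly (q $ i) t \<noteq> 0" for t using that by (simp add: poly_prod)
  \<comment> \<open>Scaling by \<open>s\<close> makes the numerator at \<open>t0\<close> the square
    of \<open>s\<close>, and the extra factor \<open>?q\<close> makes the denominator a square; both
    are positive whatever the original signs.\<close>
  define s where "s = poly P t0 * poly ?q t0"
  have s: "s \<noteq> 0" using P0 q0[OF q] by (simp add: s_def)
  define x where "x = (\<lambda>t. (t - t0) ^ ?k * (poly (smult s (P * ?q)) t / poly (?q * ?q) t))"
  have "poly (smult s (P * ?q)) t0 = s * s" by (simp add: s_def)
  then have "poly (smult s (P * ?q)) t0 > 0" using s by (metis not_real_square_gt_zero)
  moreover have "poly (?q * ?q) t0 > 0" using q0[OF q] by (metis not_real_square_gt_zero poly_mult)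
  ultimately have "posgerm t0 ?k x" unfolding posgerm_def x_def by blast
  moreover have "x t = (s *\<^sub>R n) \<bullet> (rat_curve p q t - rat_curve p q t0)"
    if "\<forall>i. poly (q $ i) t \<noteq> 0" for t
  proof -
    have "poly ?h t = (t - t0) ^ ?k * poly P t" by (subst P(1)) simp
    then have "x t = s * (poly ?h t / poly ?q t)" using q0[OF that] by (simp add: x_def)
    then show ?thesis using coord_poly_eval[OF that] by simp
  qed
  ultimately show ?thesis using that s by blast
qed

theorem theorem1:
  fixes p q :: "real poly ^ 3" and I :: "real set" and t0 :: real
  assumes "is_interval I"
    and "\<forall>i. \<forall>t\<in>I. poly (q $ i) t \<noteq> 0"
    and "proper_param p q"
    and "non_planar (rat_curve p q) I"
    and "t0 \<in> I" and "\<exists>t\<in>I. t0 < t"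
  shows "\<exists>t1\<in>I. t0 < t1 \<and> quasi_cubic (rat_curve p q) I t0 t1"
proof -
  let ?r = "rat_curve p q" and ?h = "coord_poly p q t0"
  obtain \<tau> where \<tau>: "\<tau> \<in> I" "t0 < \<tau>" using assms(6) by blast
  have I: "t \<in> I" if "t0 \<le> t" "t \<le> \<tau>" for t
    using assms(1,5) \<tau> that unfolding is_interval_1 by blast
  have nz: "?h n \<noteq> 0" if "n \<noteq> 0" for n using coord_poly_nonzero assms(2,4) that by blast
  obtain m1 m2 m3 where m: "cross3 m1 m2 \<bullet> m3 \<noteq> 0"
    "order t0 (?h m1) < order t0 (?h m2)" "order t0 (?h m2) < order t0 (?h m3)"
    using adapted_basis[of ?h, OF coord_poly_linear nz coord_poly_order_bound[OF nz]] by blast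
  have mn: "m1 \<noteq> 0" "m2 \<noteq> 0" "m3 \<noteq> 0" using m(1) by auto
  have q0: "\<forall>i. poly (q $ i) t0 \<noteq> 0" using assms(2,5) by blast
  \<comment> \<open>The curve minus its base point vanishes at \<open>t0\<close>, so even the lowest
    order is positive.\<close>
  have "poly (?h m1) t0 = 0"
    using coord_poly_eval[OF q0, of p t0 m1] q0 by (simp add: poly_prod)
  then have k1: "order t0 (?h m1) > 0" using nz[OF mn(1)] by (simp add: order_root)
  obtain s1 x where x: "s1 \<noteq> 0" "posgerm t0 (order t0 (?h m1)) x"
    "\<And>t. \<forall>i. poly (q $ i) t \<noteq> 0 \<Longrightarrow> x t = (s1 *\<^sub>R m1) \<bullet> (?r t - ?r t0)"
    using coord_posgerm[OF q0 nz[OF mn(1)]] by blast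
  obtain s2 f where f: "s2 \<noteq> 0" "posgerm t0 (order t0 (?h m2)) f"
    "\<And>t. \<forall>i. poly (q $ i) t \<noteq> 0 \<Longrightarrow> f t = (s2 *\<^sub>R m2) \<bullet> (?r t - ?r t0)"
    using coord_posgerm[OF q0 nz[OF mn(2)]] by blast
  obtain s3 g where g: "s3 \<noteq> 0" "posgerm t0 (order t0 (?h m3)) g"
    "\<And>t. \<forall>i. poly (q $ i) t \<noteq> 0 \<Longrightarrow> g t = (s3 *\<^sub>R m3) \<bullet> (?r t - ?r t0)"
    using coord_posgerm[OF q0 nz[OF mn(3)]] by blast
  \<comment> \<open>The rescaled covectors still form a basis; the flag is its dual basis.\<close>
  have "cross3 (s1 *\<^sub>R m1) (s2 *\<^sub>R m2) \<bullet> (s3 *\<^sub>R m3) \<noteq> 0"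
    using m(1) x(1) f(1) g(1) by (simp add: cross_mult_left cross_mult_right)
  then obtain e1 e2 e3 where e: "cross3 e1 e2 \<bullet> e3 \<noteq> 0"
    "\<And>v. v = ((s1 *\<^sub>R m1) \<bullet> v) *\<^sub>R e1 + ((s2 *\<^sub>R m2) \<bullet> v) *\<^sub>R e2 + ((s3 *\<^sub>R m3) \<bullet> v) *\<^sub>R e3"
    using dual_basis by blast
  have rep: "?r t = ?r t0 + x t *\<^sub>R e1 + f t *\<^sub>R e2 + g t *\<^sub>R e3" if "t0 \<le> t" "t \<le> \<tau>" for t
  proof -
    have qt: "\<forall>i. poly (q $ i) t \<noteq> 0" using assms(2) I[OF that] by blast
    show ?thesis using e(2)[of "?r t - ?r t0"] unfolding x(3)[OF qt] f(3)[OF qt] g(3)[OF qt]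
      by (simp add: algebra_simps)
  qed
  obtain y w pp x' y' w' x2 x3 y2 \<delta> where \<delta>: "\<delta> > 0"
    "\<And>b. t0 < b \<Longrightarrow> b < t0 + \<delta> \<Longrightarrow> chain t0 b x y w f pp g x' y' w'"
    "\<And>t. t0 < t \<Longrightarrow> t < t0 + \<delta> \<Longrightarrow> (x' has_real_derivative x2 t) (at t)"
    "\<And>t. t0 < t \<Longrightarrow> t < t0 + \<delta> \<Longrightarrow> (x2 has_real_derivative x3 t) (at t)"
    "\<And>t. t0 < t \<Longrightarrow> t < t0 + \<delta> \<Longrightarrow> (y' has_real_derivative y2 t) (at t)"
    by (rule posgerm_chain[OF x(2) f(2) g(2) k1 m(2,3)], rule that) assumption+
  obtain \<epsilon> where \<epsilon>: "\<epsilon> > 0" "\<And>s t. t \<in> I \<Longrightarrow> s \<in> I \<Longrightarrow> t0 < t \<Longrightarrow> t < t0 + \<epsilon> \<Longrightarrow> s \<noteq> t \<Longrightarrow> ?r s \<noteq> ?r t"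
    using proper_param_eventually_injective[OF assms(3,2)] by metis
  \<comment> \<open>Halving keeps \<open>t1\<close> strictly inside both neighbourhoods.\<close>
  define t1 where "t1 = min \<tau> (t0 + min \<delta> \<epsilon> / 2)"
  have t1: "t0 < t1" "t1 \<le> \<tau>" "t1 < t0 + \<delta>" "t1 < t0 + \<epsilon>"
    using \<tau>(2) \<delta>(1) \<epsilon>(1) by (auto simp: t1_def min_def)
  have "smooth_frame t0 t1 x y w f pp g x' y' w' ?r e1 e2 e3 x2 x3 y2"
    by (intro smooth_frame.intro frame.intro frame_axioms.intro smooth_frame_axioms.intro \<delta>(2) e(1) rep
        \<delta>(3-5)) (use t1 in auto)
  then have "quasi_cubic ?r I t0 t1"
    by (rule smooth_frame.quasi_cubic_smooth_frame) (use t1 I \<epsilon>(2) in auto)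
  then show ?thesis using t1 I by (intro bexI[of _ t1]) auto
qed

end
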